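(* Let $\lambda,\mu$ be partitions. For every $n\ge\max(\ell(\lambda),\ell(\mu))$, $$s_{\lambda/\mu}(\mathbf p\,\|\,\boldsymbol\alpha;\boldsymbol\beta)=e^{\Lambda_{-n}(\mathbf p|\boldsymbol\beta)}\det\Bigl[e^{\xi(\mathbf p;\beta_{\mu_j-j+1})}\,h_{\lambda_i-\mu_j-i+j}\bigl(\mathbf p\,\|\,\sigma^{\mu_j-j+1}\boldsymbol\alpha;\sigma^{\mu_j-j+1}\boldsymbol\beta\bigr)\Bigr]_{i,j=1}^n,$$ and for every $n\ge\max(\ell(\lambda'),\ell(\mu'))$, $$s_{\lambda/\mu}(\mathbf p\,\|\,\boldsymbol\alpha;\boldsymbol\beta)=e^{\Lambda_{n}(\mathbf p|\boldsymbol\beta)}\det\Bigl[e^{-\xi(\mathbf p;\beta_{j-\mu_j'})}\,e_{\lambda_i'-\mu_j'-i+j}\bigl(\mathbf p\,\|\,\sigma^{j-\mu_j'-1}\boldsymbol\alpha;\sigma^{j-\mu_j'-1}\boldsymbol\beta\bigr)\Bigr]_{i,j=1}^n,$$ where $\lambda',\mu'$ are the conjugate partitions.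
   Context: $\boldsymbol\alpha=(\alpha_i)_{i\in\mathbb Z}$, $\boldsymbol\beta=(\beta_i)_{i\in\mathbb Z}$ are sequences in $\mathbb C$; $(\sigma^a\boldsymbol\alpha)_i=\alpha_{i+a}$, $(\sigma^a\boldsymbol\beta)_i=\beta_{i+a}$. For $k\in\mathbb Z$, $(z;\boldsymbol\alpha)^k=\prod_{i=1}^k(1-z\alpha_i)$ if $k\ge 0$ and $\prod_{i=k+1}^{0}(1-z\alpha_i)^{-1}$ if $k<0$; $(z|\boldsymbol\beta)^k=\prod_{i=1}^k(z-\beta_i)$ if $k\ge0$ and $\prod_{i=k+1}^0(z-\beta_i)^{-1}$ if $k<0$. The Clifford algebra is generated by $\psi_i,\psi_i^*$ ($i\in\mathbb Z$) with $[\psi_i,\psi_j]_+=[\psi_i^*,\psi_j^*]_+=0$, $[\psi_i,\psi_j^*]_+=\delta_{ij}$. The charge $0$ Fock space has basis $|\lambda\rangle=v_{\lambda_1}\wedge v_{\lambda_2-1}\wedge v_{\lambda_3-2}\wedge\cdots$ over partitions $\lambda$; $\psi_j$ acts by $v_j\wedge$, $\psi_j^*$ by contraction against $v_j$; $\langle\lambda|$ is the dual basis. Normal ordering: $:\!\psi_i\psi_j^*\!:\,=\psi_i\psi_j^*$ if $i>0$, $=-\psi_j^*\psi_i$ if $i\le0$. Deformed currents for $k>0$: $J_k^{(\boldsymbol\alpha;\boldsymbol\beta)}=\sum_{i,j}A_{ij}^k:\!\psi_i\psi_j^*\!:$, the coefficient of $z^{-k}$ in $:\!\psi(z|\boldsymbol\alpha;\boldsymbol\beta)\psi^*(z|\boldsymbol\alpha;\boldsymbol\beta)\!:$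 (expanded for $|\beta_a|<|z|<|\alpha_b^{-1}|$, all $a,b$), where $\psi(z|\boldsymbol\alpha;\boldsymbol\beta)=\sum_i z\frac{(z|\boldsymbol\beta)^{i-1}}{(z;\boldsymbol\alpha)^i}\psi_i$, $\psi^*(w|\boldsymbol\alpha;\boldsymbol\beta)=\sum_j(1-\alpha_j\beta_j)\frac{(w;\boldsymbol\alpha)^{j-1}}{(w|\boldsymbol\beta)^j}\psi_j^*$; explicitly $A_{ii}^k=\beta_i^k$, $A_{ij}^k=0$ for $j<i$, and $A_{ij}^k=(1-\alpha_j\beta_j)\sum_{r-s=j-i-k}e_r(-\alpha_{i+1},\dots,-\alpha_{j-1})h_s(\beta_i,\dots,\beta_j)$ for $j>i$, with $e_r,h_s$ here the elementary and complete homogeneous symmetric polynomials. $H_+(\mathbf p|\boldsymbol\alpha;\boldsymbol\beta)=\sum_{k\ge1}\frac{p_k}{k}J_k^{(\boldsymbol\alpha;\boldsymbol\beta)}$ with $\mathbf p=(p_1,p_2,\dots)$ indeterminates. Skew double factorial Schur functions: $s_{\lambda/\mu}(\mathbf p\,\|\,\boldsymbol\alpha;\boldsymbol\beta)=\langle\mu|e^{H_+(\mathbf p|\boldsymbol\alpha;\boldsymbol\beta)}|\lambda\rangle$, and $s_\lambda=s_{\lambda/\varnothing}$. Set $h_k(\mathbf p\,\|\,\boldsymbol\alpha;\boldsymbol\beta)=s_{(k)}(\mathbf p\,\|\,\boldsymbol\alpha;\boldsymbol\beta)$, $e_k(\mathbf p\,\|\,\boldsymbol\alpha;\boldsymbol\beta)=s_{(1^k)}(\mathbf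 p\,\|\,\boldsymbol\alpha;\boldsymbol\beta)$ for $k\ge0$, and $0$ for $k<0$. $\xi(\mathbf p;z)=\sum_{k\ge1}\frac{p_k}{k}z^k$; $\Lambda_m(\mathbf p|\boldsymbol\beta)=\sum_{k\ge1}\frac{p_k}{k}\bigl(\sum_{0<j\le m}\beta_j^k-\sum_{m<j\le0}\beta_j^k\bigr)$. *)

theory Defs
  imports Complex_Main "HOL-Library.Multiset" "Jordan_Normal_Form.Determinant"
begin

section \<open>Formal power series in arbitrarily many indeterminates\<close>

text \<open>
  A monomial is the multiset of its indeterminates, so the product of monomials is the sum of
  multisets and the total degree of a monomial is its size.  A series is an arbitrary family of
  coefficients.
\<close>

typedef ('v, 'a) mfps = "UNIV :: ('v multiset \<Rightarrow> 'a) set"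
  morphisms mfps_nth Abs_mfps
  by simp

lemma mfps_nth_Abs [simp]: "mfps_nth (Abs_mfps f) = f"
  by (simp add: Abs_mfps_inverse)

lemma mfps_eqI: "(\<And>m. mfps_nth f m = mfps_nth g m) \<Longrightarrow> f = g"
  by (metis ext mfps_nth_inject)

lemma finite_mset_splits: "finite {(A, B). A + B = (M :: 'v multiset)}"
proof -
  have "{A. A \<subseteq># M} \<subseteq> (\<Union>k\<le>size M. multisets_of_size (set_mset M) k)"
    using set_mset_mono size_mset_mono by (fastforce simp: multisets_of_size_def)
  moreover have "finite (\<Union>k\<le>size M. multisets_of_size (set_mset M) k)"
    by (intro finite_UN_I finite_multisets_of_size) auto
  ultimately have "finite {A. A \<subseteq># M}"
    by (rule finite_subset)
  then have "finite ((\<lambda>A. (A, M - A)) ` {A. A \<subseteq># M})"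
    by simp
  moreover have "{(A, B). A + B = M} \<subseteq> (\<lambda>A. (A, M - A)) ` {A. A \<subseteq># M}"
    by (force simp: image_iff)
  ultimately show ?thesis
    by (rule finite_subset[rotated])
qed

instantiation mfps :: (type, comm_ring_1) comm_ring_1
begin

definition zero_mfps :: "('a, 'b) mfps" where
  "zero_mfps = Abs_mfps (\<lambda>_. 0)"

definition one_mfps :: "('a, 'b) mfps" where
  "one_mfps = Abs_mfps (\<lambda>m. if m = {#} then 1 else 0)"

definition plus_mfps :: "('a, 'b) mfps \<Rightarrow> ('a, 'b) mfps \<Rightarrow> ('a, 'b) mfps" where
  "plus_mfps f g = Abs_mfps (\<lambda>m. mfps_nth f m + mfps_nth g m)"

definition minus_mfps :: "('a, 'b) mfps \<Rightarrow> ('a, 'b) mfps \<Rightarrow> ('a, 'b) mfps" where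
  "minus_mfps f g = Abs_mfps (\<lambda>m. mfps_nth f m - mfps_nth g m)"

definition uminus_mfps :: "('a, 'b) mfps \<Rightarrow> ('a, 'b) mfps" where
  "uminus_mfps f = Abs_mfps (\<lambda>m. - mfps_nth f m)"

definition times_mfps :: "('a, 'b) mfps \<Rightarrow> ('a, 'b) mfps \<Rightarrow> ('a, 'b) mfps" where
  "times_mfps f g = Abs_mfps (\<lambda>m. \<Sum>(A, B) | A + B = m. mfps_nth f A * mfps_nth g B)"

lemma mfps_nth_simps:
  "mfps_nth 0 m = (0 :: 'b)"
  "mfps_nth 1 m = (if m = {#} then 1 else (0 :: 'b))"
  "mfps_nth (f + g) m = mfps_nth f m + mfps_nth g (m :: 'a multiset)"
  "mfps_nth (f - g) m = mfps_nth f m - mfps_nth g m"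
  "mfps_nth (- f) m = - mfps_nth f m"
  "mfps_nth (f * g) m = (\<Sum>(A, B) | A + B = m. mfps_nth f A * mfps_nth g B)"
  by (simp_all add: zero_mfps_def one_mfps_def plus_mfps_def minus_mfps_def uminus_mfps_def
      times_mfps_def)

lemma mfps_mult_assoc: "f * g * h = f * (g * (h :: ('a, 'b) mfps))"
proof (rule mfps_eqI)
  fix M :: "'a multiset"
  let ?f = "mfps_nth f" and ?g = "mfps_nth g" and ?h = "mfps_nth h"
  let ?S = "\<lambda>M :: 'a multiset. {(A, B). A + B = M}"
  have "mfps_nth (f * g * h) M = (\<Sum>p\<in>?S M. \<Sum>q\<in>?S (fst p). ?f (fst q) * ?g (snd q) * ?h (snd p))"
    by (simp add: mfps_nth_simps sum_distrib_right case_prod_unfold)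
  also have "\<dots> = (\<Sum>(p, q)\<in>(SIGMA p:?S M. ?S (fst p)). ?f (fst q) * ?g (snd q) * ?h (snd p))"
    by (subst sum.Sigma) (auto simp: finite_mset_splits)
  also have "\<dots> = (\<Sum>(p, q)\<in>(SIGMA p:?S M. ?S (snd p)). ?f (fst p) * ?g (fst q) * ?h (snd q))"
    by (rule sum.reindex_bij_witness
        [where i = "\<lambda>(p, q). ((fst p + fst q, snd q), (fst p, fst q))"
           and j = "\<lambda>(p, q). ((fst q, snd q + snd p), (snd q, snd p))"]) (auto simp: add.assoc)
  also have "\<dots> = (\<Sum>p\<in>?S M. \<Sum>q\<in>?S (snd p). ?f (fst p) * ?g (fst q) * ?h (snd q))"
    by (subst sum.Sigma) (auto simp: finite_mset_splits)
  also have "\<dots> = mfps_nth (f * (g * h)) M"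
    by (simp add: mfps_nth_simps sum_distrib_left case_prod_unfold mult.assoc)
  finally show "mfps_nth (f * g * h) M = mfps_nth (f * (g * h)) M" .
qed

lemma mfps_mult_commute: "f * g = g * (f :: ('a, 'b) mfps)"
proof (rule mfps_eqI)
  fix M :: "'a multiset"
  show "mfps_nth (f * g) M = mfps_nth (g * f) M"
    unfolding mfps_nth_simps
    by (rule sum.reindex_bij_witness[where i = prod.swap and j = prod.swap])
      (auto simp: add.commute mult.commute)
qed

lemma mfps_mult_1: "1 * f = (f :: ('a, 'b) mfps)"
proof (rule mfps_eqI)
  fix M :: "'a multiset"
  have "mfps_nth (1 * f) M = (\<Sum>(A, B)\<in>{({#}, M)}. mfps_nth 1 A * mfps_nth f B)"
    unfolding mfps_nth_simps(6)
    by (rule sum.mono_neutral_right) (auto simp: finite_mset_splits mfps_nth_simps split: if_splits)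
  then show "mfps_nth (1 * f) M = mfps_nth f M"
    by (simp add: mfps_nth_simps)
qed

instance
proof
  fix f g h :: "('a, 'b) mfps"
  show "f * g * h = f * (g * h)" by (rule mfps_mult_assoc)
  show "f * g = g * f" by (rule mfps_mult_commute)
  show "1 * f = f" by (rule mfps_mult_1)
  show "f + g + h = f + (g + h)" "f + g = g + f" "0 + f = f" "- f + f = 0" "f - g = f + - g"
    by (rule mfps_eqI, simp add: mfps_nth_simps add_ac)+
  show "(f + g) * h = f * h + g * h"
    by (rule mfps_eqI)
      (simp add: mfps_nth_simps distrib_right sum.distrib case_prod_unfold)
  have "mfps_nth (0 :: ('a, 'b) mfps) {#} \<noteq> mfps_nth 1 {#}"
    by (simp add: mfps_nth_simps)
  then show "(0 :: ('a, 'b) mfps) \<noteq> 1" by metis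
qed

end

definition mfps_const :: "'a \<Rightarrow> ('v, 'a :: comm_ring_1) mfps" where
  "mfps_const c = Abs_mfps (\<lambda>m. if m = {#} then c else 0)"

definition mfps_var :: "'v \<Rightarrow> ('v, 'a :: comm_ring_1) mfps" where
  "mfps_var v = Abs_mfps (\<lambda>m. if m = {#v#} then 1 else 0)"

text \<open>
  Formal (coefficientwise) sum of a family in which every monomial occurs in only finitely
  many members.
\<close>

definition formal_sum :: "'i set \<Rightarrow> ('i \<Rightarrow> ('v, 'a :: comm_ring_1) mfps) \<Rightarrow> ('v, 'a) mfps" where
  "formal_sum I f = Abs_mfps (\<lambda>m. \<Sum>i | i \<in> I \<and> mfps_nth (f i) m \<noteq> 0. mfps_nth (f i) m)"

text \<open>Meaningful for series without constant term.\<close>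

definition mfps_exp :: "('v, 'a :: field_char_0) mfps \<Rightarrow> ('v, 'a) mfps" where
  "mfps_exp f = formal_sum UNIV (\<lambda>n. mfps_const (1 / fact n) * f ^ n)"

text \<open>
  The coefficient ring.  The indeterminate \<open>p\<^sub>k\<close> is \<open>pvar k\<close> for \<open>k \<ge> 1\<close>; the indeterminate
  with index \<open>0\<close> never occurs.
\<close>

type_synonym series = "(nat, complex) mfps"

definition pvar :: "nat \<Rightarrow> series" where
  "pvar k = mfps_var k"

definition xi :: "complex \<Rightarrow> series" where
  "xi z = formal_sum {1..} (\<lambda>k. mfps_const (z ^ k / of_nat k) * pvar k)"

definition Lam :: "int \<Rightarrow> (int \<Rightarrow> complex) \<Rightarrow> series" where
  "Lam m \<beta> = formal_sum {1..} (\<lambda>k.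
     mfps_const (((\<Sum>j\<in>{0<..m}. \<beta> j ^ k) - (\<Sum>j\<in>{m<..0}. \<beta> j ^ k)) / of_nat k) * pvar k)"


section \<open>Partitions\<close>

definition is_partition :: "nat list \<Rightarrow> bool" where
  "is_partition la \<longleftrightarrow> sorted_wrt (\<ge>) la \<and> 0 \<notin> set la"

text \<open>Parts are numbered from \<open>1\<close>, and the length \<open>\<ell>\<close> of a partition is its length as a list.\<close>

definition part :: "nat list \<Rightarrow> nat \<Rightarrow> nat" where
  "part la i = (if 1 \<le> i \<and> i \<le> length la then la ! (i - 1) else 0)"

definition conj_partition :: "nat list \<Rightarrow> nat list" where
  "conj_partition la = map (\<lambda>j. card {i. 1 \<le> i \<and> j \<le> part la i}) [1..<part la 1 + 1]"


section \<open>Fock space and fermions\<close>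

text \<open>
  A decreasing semi-infinite wedge \<open>v\<^bsub>s\<^sub>1\<^esub> \<and> v\<^bsub>s\<^sub>2\<^esub> \<and> \<dots>\<close> is encoded by the set
  \<open>S = {s\<^sub>1, s\<^sub>2, \<dots>}\<close>, and a vector by the function sending \<open>S\<close> to its coefficient at that
  wedge.  The Fock space (of all charges) is the subspace \<open>fock\<close>; the operators below
  are written for arbitrary functions, but are meant on \<open>fock\<close>, where they satisfy the
  Clifford relations and where the sums defining the currents are finite.
\<close>

type_synonym fvec = "int set \<Rightarrow> series"

definition maya :: "int set \<Rightarrow> bool" where
  "maya S \<longleftrightarrow> finite (S \<inter> {0<..}) \<and> finite ({..0} - S)"

definition fock :: "fvec set" where
  "fock = {v. finite {S. v S \<noteq> 0} \<and> (\<forall>S. v S \<noteq> 0 \<longrightarrow> maya S)}"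

definition wedge_sign :: "int \<Rightarrow> int set \<Rightarrow> series" where
  "wedge_sign j S = (- 1) ^ card {s \<in> S. j < s}"

text \<open>
  Transposed form of \<open>v\<^sub>S \<mapsto> v\<^sub>j \<and> v\<^sub>S\<close> and of the contraction: \<open>v\<^sub>S\<close> occurs in \<open>v\<^sub>j \<and> v\<^sub>T\<close>
  iff \<open>j \<in> S\<close> and \<open>T = S - {j}\<close>.
\<close>

definition psi :: "int \<Rightarrow> fvec \<Rightarrow> fvec" where
  "psi j v = (\<lambda>S. if j \<in> S then wedge_sign j S * v (S - {j}) else 0)"

definition psi_star :: "int \<Rightarrow> fvec \<Rightarrow> fvec" where
  "psi_star j v = (\<lambda>S. if j \<in> S then 0 else wedge_sign j S * v (insert j S))"

lemma maya_insert [simp]: "maya (insert j S) \<longleftrightarrow> maya S"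
proof -
  have "insert j S \<inter> {0<..} \<subseteq> insert j (S \<inter> {0<..})" "S \<inter> {0<..} \<subseteq> insert j S \<inter> {0<..}"
    "{..0} - S \<subseteq> insert j ({..0} - insert j S)" "{..0} - insert j S \<subseteq> {..0} - S"
    by auto
  then show ?thesis
    unfolding maya_def by (meson finite_insert finite_subset)
qed

lemma maya_remove [simp]: "maya (S - {j}) \<longleftrightarrow> maya S"
  by (metis insert_Diff_single maya_insert)

lemma maya_finite_above: "maya S \<Longrightarrow> finite {s \<in> S. j < s}"
proof -
  assume "maya S"
  then have "finite (S \<inter> {0<..} \<union> {j<..0})"
    by (simp add: maya_def)
  then show ?thesis
    by (rule finite_subset[rotated]) auto
qed

lemma psi_fock:
  assumes v: "v \<in> fock"
  shows "psi j v \<in> fock"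
proof -
  have S: "S \<in> insert j ` {S. v S \<noteq> 0} \<and> maya S" if "psi j v S \<noteq> 0" for S
  proof -
    have *: "j \<in> S" "v (S - {j}) \<noteq> 0"
      using that by (auto simp: psi_def split: if_splits)
    then have "maya (S - {j})"
      using v unfolding fock_def by blast
    moreover have "S = insert j (S - {j})"
      using *(1) by auto
    then have "S \<in> insert j ` {S. v S \<noteq> 0}"
      by (rule image_eqI) (simp add: *(2))
    ultimately show ?thesis by simp
  qed
  then have "{S. psi j v S \<noteq> 0} \<subseteq> insert j ` {S. v S \<noteq> 0}"
    by blast
  moreover have "finite (insert j ` {S. v S \<noteq> 0})"
    using v by (simp add: fock_def)
  ultimately show ?thesis
    using S by (auto simp: fock_def dest: finite_subset)
qed

lemma psi_star_fock:
  assumes v: "v \<in> fock"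
  shows "psi_star j v \<in> fock"
proof -
  have S: "S \<in> (\<lambda>T. T - {j}) ` {S. v S \<noteq> 0} \<and> maya S" if "psi_star j v S \<noteq> 0" for S
  proof -
    have *: "j \<notin> S" "v (insert j S) \<noteq> 0"
      using that by (auto simp: psi_star_def split: if_splits)
    then have "maya (insert j S)"
      using v unfolding fock_def by blast
    moreover have "S = insert j S - {j}"
      using *(1) by auto
    ultimately show ?thesis
      using *(2) by auto
  qed
  then have "{S. psi_star j v S \<noteq> 0} \<subseteq> (\<lambda>T. T - {j}) ` {S. v S \<noteq> 0}"
    by blast
  moreover have "finite ((\<lambda>T. T - {j}) ` {S. v S \<noteq> 0})"
    using v by (simp add: fock_def)
  ultimately show ?thesis
    using S by (auto simp: fock_def dest: finite_subset)
qed

lemma wedge_sign_square [simp]: "wedge_sign j S * (wedge_sign j S * x) = x"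
proof -
  have "wedge_sign j S * wedge_sign j S = 1"
    by (simp add: wedge_sign_def)
  then show ?thesis
    by (simp only: mult.assoc[symmetric] mult_1_left)
qed

lemma wedge_sign_self [simp]:
  "wedge_sign j (insert j S) = wedge_sign j S" "wedge_sign j (S - {j}) = wedge_sign j S"
  proof -
  have "{s \<in> insert j S. j < s} = {s \<in> S. j < s}" "{s \<in> S - {j}. j < s} = {s \<in> S. j < s}"
    by auto
  then show "wedge_sign j (insert j S) = wedge_sign j S" "wedge_sign j (S - {j}) = wedge_sign j S"
    by (simp_all only: wedge_sign_def)
qed

lemma wedge_sign_insert:
  assumes "maya S" "i \<notin> S" "i \<noteq> j"
  shows "wedge_sign j (insert i S) = (if j < i then - wedge_sign j S else wedge_sign j S)"
proof -
  have "{s \<in> insert i S. j < s} = (if j < i then insert i {s \<in> S. j < s} else {s \<in> S. j < s})"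
    by auto
  then show ?thesis
    using assms maya_finite_above[OF assms(1), of j] by (simp add: wedge_sign_def)
qed

lemma wedge_sign_remove:
  assumes "maya S" "i \<in> S" "i \<noteq> j"
  shows "wedge_sign j (S - {i}) = (if j < i then - wedge_sign j S else wedge_sign j S)"
  using wedge_sign_insert[of "S - {i}" i j] assms by (simp add: insert_absorb split: if_splits)

lemma psi_psi:
  assumes "v \<in> fock"
  shows "psi i (psi j v) S + psi j (psi i v) S = 0"
proof (cases "maya S")
  case True
  have "S - {i} - {j} = S - {j} - {i}" by auto
  with True show ?thesis
    by (cases "i = j") (auto simp: psi_def wedge_sign_remove)
next
  case False
  then have "v (S - {j} - {i}) = 0" "v (S - {i} - {j}) = 0"
    using assms by (auto simp: fock_def)
  then show ?thesis by (simp add: psi_def)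
qed

lemma psi_star_psi_star:
  assumes "v \<in> fock"
  shows "psi_star i (psi_star j v) S + psi_star j (psi_star i v) S = 0"
proof (cases "maya S")
  case True
  then show ?thesis
    by (cases "i = j") (auto simp: psi_star_def wedge_sign_insert insert_commute)
next
  case False
  then have "v (insert i (insert j S)) = 0" "v (insert j (insert i S)) = 0"
    using assms by (auto simp: fock_def)
  then show ?thesis by (simp add: psi_star_def)
qed

lemma psi_psi_star:
  assumes "v \<in> fock"
  shows "psi i (psi_star j v) S + psi_star j (psi i v) S = (if i = j then v S else 0)"
proof (cases "maya S")
  case True
  then show ?thesis
    by (cases "i = j")
      (auto simp: psi_def psi_star_def wedge_sign_insert wedge_sign_remove insert_Diff_if insert_absorb)
next
  case False
  then have "v S = 0" "v (insert j (S - {i})) = 0" "v (insert j S - {i}) = 0"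
    using assms by (auto simp: fock_def)
  then show ?thesis by (simp add: psi_def psi_star_def insert_absorb)
qed

definition normal_ordered :: "int \<Rightarrow> int \<Rightarrow> fvec \<Rightarrow> fvec" where
  "normal_ordered i j v =
     (if 0 < i then psi i (psi_star j v) else (\<lambda>S. - psi_star j (psi i v) S))"

definition part_set :: "nat list \<Rightarrow> int set" where
  "part_set la = {int (part la i) - int i + 1 | i. 1 \<le> i}"

definition ket :: "nat list \<Rightarrow> fvec" where
  "ket la = (\<lambda>S. if S = part_set la then 1 else 0)"


section \<open>Deformed currents\<close>

definition elem_sym :: "nat \<Rightarrow> 'i set \<Rightarrow> ('i \<Rightarrow> complex) \<Rightarrow> complex" where
  "elem_sym r I x = (\<Sum>X | X \<subseteq> I \<and> card X = r. \<Prod>i\<in>X. x i)"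

definition comp_sym :: "nat \<Rightarrow> 'i set \<Rightarrow> ('i \<Rightarrow> complex) \<Rightarrow> complex" where
  "comp_sym s I x = (\<Sum>X\<in>multisets_of_size I s. \<Prod>i\<in>#X. x i)"

text \<open>
  Coefficient of \<open>\<psi>\<^sub>i \<psi>\<^sub>j\<^sup>*\<close> in the \<open>k\<close>-th current, i.e. the coefficient of \<open>z\<^sup>-\<^sup>k\<close> in
  \<open>z (z|\<beta>)\<^sup>i\<^sup>-\<^sup>1 / (z;\<alpha>)\<^sup>i \<cdot> (1 - \<alpha>\<^sub>j \<beta>\<^sub>j) (z;\<alpha>)\<^sup>j\<^sup>-\<^sup>1 / (z|\<beta>)\<^sup>j\<close>.  The bound on \<open>r\<close> only drops
  terms in which the elementary symmetric polynomial has too few variables.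
\<close>

definition current_coeff ::
  "(int \<Rightarrow> complex) \<Rightarrow> (int \<Rightarrow> complex) \<Rightarrow> nat \<Rightarrow> int \<Rightarrow> int \<Rightarrow> complex" where
  "current_coeff \<alpha> \<beta> k i j =
     (if j < i then 0
      else if i = j then \<beta> i ^ k
      else (1 - \<alpha> j * \<beta> j) *
        (\<Sum>(r, s) | int r - int s = j - i - int k \<and> int r < j - i.
           elem_sym r {i+1..j-1} (\<lambda>l. - \<alpha> l) * comp_sym s {i..j} \<beta>))"

definition current :: "(int \<Rightarrow> complex) \<Rightarrow> (int \<Rightarrow> complex) \<Rightarrow> nat \<Rightarrow> fvec \<Rightarrow> fvec" where
  "current \<alpha> \<beta> k v = (\<lambda>S.
     formal_sum UNIV (\<lambda>(i, j). mfps_const (current_coeff \<alpha> \<beta> k i j) * normal_ordered i j v S))"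

lemma finite_current_support:
  assumes "v \<in> fock"
  shows "finite {(i, j). \<exists>k S. mfps_const (current_coeff \<alpha> \<beta> k i j) * normal_ordered i j v S \<noteq> 0}"
proof -
  let ?P = "\<Union>T\<in>{T. v T \<noteq> 0}. ({..0} - T \<union> T \<inter> {0<..})"
  have fin: "finite ?P"
    using assms by (auto simp: fock_def maya_def)
  define a b where "a = Min (insert 0 ?P)" and "b = Max (insert 0 ?P)"
  have ab: "a \<le> x \<and> x \<le> b" if "x \<in> ?P" for x
    using that fin unfolding a_def b_def by (meson Max_ge Min_le finite_insert insertI2)
  have ab0: "a \<le> 0" "0 \<le> b"
    using fin unfolding a_def b_def by (simp_all add: Min_le Max_ge)
  have c0: "mfps_const 0 = (0 :: series)"
    by (rule mfps_eqI) (simp add: mfps_const_def mfps_nth_simps)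
  have "a \<le> i \<and> i \<le> b \<and> a \<le> j \<and> j \<le> b"
    if nz: "mfps_const (current_coeff \<alpha> \<beta> k i j) * normal_ordered i j v S \<noteq> 0" for i j k S
  proof -
    have ij: "i \<le> j"
    proof (rule ccontr)
      assume "\<not> i \<le> j"
      then show False using nz by (simp add: current_coeff_def c0)
    qed
    have nz': "normal_ordered i j v S \<noteq> 0"
      using nz by auto
    have "\<exists>T. v T \<noteq> 0 \<and> (if 0 < i then j \<in> T else i \<notin> T \<and> (i = j \<or> j \<in> T))"
    proof (cases "0 < i")
      case True
      then have "v (insert j (S - {i})) \<noteq> 0"
        using nz' by (auto simp: normal_ordered_def psi_def psi_star_def split: if_splits)
      with True show ?thesis by auto
    next
      case False
      then have "v (insert j S - {i}) \<noteq> 0"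
        using nz' by (auto simp: normal_ordered_def psi_def psi_star_def split: if_splits)
      with False show ?thesis by (intro exI[of _ "insert j S - {i}"]) auto
    qed
    then obtain T where T: "v T \<noteq> 0"
      and T': "if 0 < i then j \<in> T else i \<notin> T \<and> (i = j \<or> j \<in> T)" by blast
    show ?thesis
    proof (cases "0 < i")
      case True
      then have "j \<in> ?P" using T T' ij by auto
      then show ?thesis using ab[of j] ab0 True ij by auto
    next
      case False
      then have "i \<in> ?P" using T T' by auto
      then have i: "a \<le> i" using ab by blast
      have "j \<le> b"
      proof (cases "0 < j")
        case True
        then have "j \<in> ?P" using T T' False by auto
        then show ?thesis using ab by blast
      qed (use ab0 in auto)
      then show ?thesis using i ij by auto
    qed
  qed
  then have "{(i, j). \<exists>k S. mfps_const (current_coeff \<alpha> \<beta> k i j) * normal_ordered i j v S \<noteq> 0}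
      \<subseteq> {a..b} \<times> {a..b}"
    by auto
  then show ?thesis
    by (rule finite_subset) simp
qed

definition H_plus :: "(int \<Rightarrow> complex) \<Rightarrow> (int \<Rightarrow> complex) \<Rightarrow> fvec \<Rightarrow> fvec" where
  "H_plus \<alpha> \<beta> v = (\<lambda>S.
     formal_sum {1..} (\<lambda>k. mfps_const (1 / of_nat k) * pvar k * current \<alpha> \<beta> k v S))"

lemma normal_ordered_fock: "v \<in> fock \<Longrightarrow> normal_ordered i j v \<in> fock"
proof -
  assume v: "v \<in> fock"
  have "psi i (psi_star j v) \<in> fock" "psi_star j (psi i v) \<in> fock"
    using v by (simp_all add: psi_fock psi_star_fock)
  then show ?thesis
    by (simp add: normal_ordered_def fock_def)
qed

lemma formal_sum_zero: "(\<And>i. i \<in> I \<Longrightarrow> f i = 0) \<Longrightarrow> formal_sum I f = 0"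
  by (rule mfps_eqI) (auto simp: formal_sum_def mfps_nth_simps intro!: sum.neutral)

lemma H_plus_fock:
  assumes v: "v \<in> fock"
  shows "H_plus \<alpha> \<beta> v \<in> fock"
proof -
  define P where
    "P = {(i, j). \<exists>k S. mfps_const (current_coeff \<alpha> \<beta> k i j) * normal_ordered i j v S \<noteq> 0}"
  define Q where "Q = (\<Union>(i, j)\<in>P. {S. normal_ordered i j v S \<noteq> 0})"
  have no: "finite {S. normal_ordered i j v S \<noteq> 0}" "normal_ordered i j v S \<noteq> 0 \<Longrightarrow> maya S"
    for i j S
    using normal_ordered_fock[OF v, of i j] unfolding fock_def by blast+
  have "finite P"
    unfolding P_def by (rule finite_current_support[OF v])
  then have Q: "finite Q" "\<And>S. S \<in> Q \<Longrightarrow> maya S"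
    using no by (auto simp: Q_def)
  have "H_plus \<alpha> \<beta> v S = 0" if "S \<notin> Q" for S
  proof -
    have "mfps_const (current_coeff \<alpha> \<beta> k i j) * normal_ordered i j v S = 0" for k i j
    proof (cases "(i, j) \<in> P")
      case True
      then have "normal_ordered i j v S = 0"
        using that by (auto simp: Q_def)
      then show ?thesis by simp
    next
      case False
      then show ?thesis by (auto simp: P_def)
    qed
    then have "current \<alpha> \<beta> k v S = 0" for k
      unfolding current_def by (intro formal_sum_zero) auto
    then show ?thesis
      unfolding H_plus_def by (intro formal_sum_zero) simp
  qed
  then have "{S. H_plus \<alpha> \<beta> v S \<noteq> 0} \<subseteq> Q" by blast
  then show ?thesis
    using Q by (auto simp: fock_def intro: finite_subset)
qed

definition exp_H_plus :: "(int \<Rightarrow> complex) \<Rightarrow> (int \<Rightarrow> complex) \<Rightarrow> fvec \<Rightarrow> fvec" where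
  "exp_H_plus \<alpha> \<beta> v = (\<lambda>S.
     formal_sum UNIV (\<lambda>n. mfps_const (1 / fact n) * (H_plus \<alpha> \<beta> ^^ n) v S))"


section \<open>Double factorial Schur functions\<close>

text \<open>
  \<open>skew_schur la mu \<alpha> \<beta>\<close> is \<open>\<langle>mu| exp H\<^sub>+ |la\<rangle>\<close>: pairing with \<open>\<langle>mu|\<close> reads off a coefficient.
\<close>

definition skew_schur ::
  "nat list \<Rightarrow> nat list \<Rightarrow> (int \<Rightarrow> complex) \<Rightarrow> (int \<Rightarrow> complex) \<Rightarrow> series" where
  "skew_schur la mu \<alpha> \<beta> = exp_H_plus \<alpha> \<beta> (ket la) (part_set mu)"

definition schur :: "nat list \<Rightarrow> (int \<Rightarrow> complex) \<Rightarrow> (int \<Rightarrow> complex) \<Rightarrow> series" where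
  "schur la \<alpha> \<beta> = skew_schur la [] \<alpha> \<beta>"

definition h_fun :: "int \<Rightarrow> (int \<Rightarrow> complex) \<Rightarrow> (int \<Rightarrow> complex) \<Rightarrow> series" where
  "h_fun k \<alpha> \<beta> =
     (if k < 0 then 0 else schur (if k = 0 then [] else [nat k]) \<alpha> \<beta>)"

definition e_fun :: "int \<Rightarrow> (int \<Rightarrow> complex) \<Rightarrow> (int \<Rightarrow> complex) \<Rightarrow> series" where
  "e_fun k \<alpha> \<beta> = (if k < 0 then 0 else schur (replicate (nat k) 1) \<alpha> \<beta>)"

definition shift :: "int \<Rightarrow> (int \<Rightarrow> complex) \<Rightarrow> int \<Rightarrow> complex" where
  "shift a \<alpha> = (\<lambda>i. \<alpha> (i + a))"

text \<open>Determinant of a matrix with rows and columns indexed by \<open>1, \<dots>, n\<close>.\<close>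

definition det1 :: "nat \<Rightarrow> (nat \<Rightarrow> nat \<Rightarrow> 'a :: comm_ring_1) \<Rightarrow> 'a" where
  "det1 n M = det (mat n n (\<lambda>(i, j). M (i + 1) (j + 1)))"

end

theory Submission
  imports Defs
begin

text \<open>
  Write \<open>H\<^sub>+ = \<Sum> A\<^sub>i\<^sub>j :\<psi>\<^sub>i \<psi>\<^sub>j\<^sup>*:\<close>.  The matrix \<open>A\<close> is upper triangular, its entries are linear forms in the
  \<open>p\<^sub>k\<close>, its diagonal is \<open>\<xi>(p; \<beta>\<^sub>i)\<close>, and translating \<open>\<alpha>\<close> and \<open>\<beta>\<close> translates its indices.  These
  properties of \<open>A\<close> imply the theorem.

  A quadratic operator acts on a wedge product factor by factor, as \<open>[H\<^sub>+, \<Psi>(w)] = \<Psi>(A w)\<close> for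
  \<open>\<Psi>(w) = \<Sum> w\<^sub>a \<psi>\<^sub>a\<close>.  Hence \<open>e\<^bsup>H\<^sub>+\<^esup>\<close> replaces each factor \<open>v\<^sub>y\<close> of \<open>|\<lambda>\<rangle>\<close> by the column \<open>y\<close> of \<open>e\<^sup>A\<close>.  Since \<open>A\<close>
  is triangular, the filled positions \<open>\<le> -n\<close> can be split off: they form a vacuum on which \<open>H\<^sub>+\<close> acts by
  the scalar \<open>\<Lambda>\<^bsub>-n\<^esub>\<close>, a correction due to normal ordering.  The coefficient at \<open>\<langle>\<mu>|\<close> is therefore
  \<open>e\<^bsup>\<Lambda>\<^bsub>-n\<^esub>\<^esup>\<close> times the minor of \<open>e\<^sup>A\<close> with rows \<open>\<mu>\<^sub>j - j + 1\<close> and columns \<open>\<lambda>\<^sub>i - i + 1\<close>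
  (\<open>evolve_eq_det\<close>, \<open>skew_schur_particles\<close>).  The case of a single row and \<open>n = 1\<close> shows that the entries
  of \<open>e\<^sup>A\<close> are the functions \<open>h\<^sub>k\<close> with translated parameters, up to the factor \<open>e\<^bsup>\<xi>\<^esup>\<close>
  (\<open>exp_xi_h_fun\<close>), and this is the first formula.

  The argument is made rigorous inside the ring of power series without a time variable.  As \<open>A\<close> is
  linear in the \<open>p\<^sub>k\<close>, the total degree plays the role of the exponent of time: both \<open>e\<^bsup>H\<^sub>+\<^esup>|\<lambda>\<rangle>\<close> and the
  wedge product of columns, rescaled by \<open>e\<^bsup>\<Lambda>\<^bsub>-n\<^esub>\<^esup>\<close>, satisfy \<open>\<theta> F = H\<^sub>+ F\<close> for the Euler derivation \<open>\<theta>\<close>, and a solution is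
  determined by its constant term (\<open>quadratic_flow_unique\<close>).

  The second formula is the first one for the holes.  Under the reflected complement
  \<open>S \<mapsto> {s. 1 - s \<notin> S}\<close>, which is conjugation of partitions (\<open>part_set_conj_partition\<close>), the flow of \<open>A\<close>
  becomes the flow of a matrix of the same kind, namely \<open>-A\<close> reflected, transposed and conjugated by
  alternating signs (\<open>evolve_holes\<close>).  The case of a single column identifies the entries of its
  exponential with the functions \<open>e\<^sub>k\<close> (\<open>exp_xi_e_fun\<close>).
\<close>

section \<open>Graded power series and the Euler derivation\<close>

definition homogeneous :: "nat \<Rightarrow> ('v, 'a :: comm_ring_1) mfps \<Rightarrow> bool" where
  "homogeneous n f \<longleftrightarrow> (\<forall>m. mfps_nth f m \<noteq> 0 \<longrightarrow> size m = n)"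

definition euler :: "('v, 'a :: comm_ring_1) mfps \<Rightarrow> ('v, 'a) mfps" where
  "euler f = Abs_mfps (\<lambda>m. of_nat (size m) * mfps_nth f m)"

text \<open>
  The exponential \<open>\<Sum>\<^sub>n f\<^sub>n / n!\<close> of a sequence in which \<open>f\<^sub>n\<close> is homogeneous of degree \<open>n\<close>: then the
  coefficient at a monomial of degree \<open>n\<close> comes from \<open>f\<^sub>n\<close> alone.  All exponentials below (of
  series, of triangular matrices, of currents) have this shape.
\<close>

definition egf :: "(nat \<Rightarrow> ('v, 'a :: field_char_0) mfps) \<Rightarrow> ('v, 'a) mfps" where
  "egf f = Abs_mfps (\<lambda>m. mfps_nth (f (size m)) m / fact (size m))"

lemma mfps_nth_sum: "mfps_nth (sum f I) m = (\<Sum>i\<in>I. mfps_nth (f i) m)"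
  by (induction I rule: infinite_finite_induct) (simp_all add: mfps_nth_simps)

lemma mfps_nth_const_mult [simp]:
  fixes f :: "('v, 'a :: comm_ring_1) mfps"
  shows "mfps_nth (mfps_const c * f) m = c * mfps_nth f m"
proof -
  have "mfps_nth (mfps_const c * f) m = (\<Sum>(A, B)\<in>{({#} :: 'v multiset, m)}. mfps_nth (mfps_const c) A * mfps_nth f B)"
    unfolding mfps_nth_simps(6)
    by (rule sum.mono_neutral_right) (auto simp: finite_mset_splits mfps_const_def split: if_splits)
  then show ?thesis by (simp add: mfps_const_def)
qed

lemma mfps_nth_mult_empty [simp]: "mfps_nth (f * g) {#} = mfps_nth f {#} * mfps_nth g {#}"
proof -
  have "{(A, B). A + B = ({#} :: 'a multiset)} = {({#}, {#})}" by auto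
  then show ?thesis by (simp add: mfps_nth_simps)
qed

lemma homogeneousD: "homogeneous n f \<Longrightarrow> size m \<noteq> n \<Longrightarrow> mfps_nth f m = 0"
  by (auto simp: homogeneous_def)

lemma homogeneous_0 [simp]: "homogeneous n 0"
  by (simp add: homogeneous_def mfps_nth_simps)

lemma homogeneous_1 [simp]: "homogeneous 0 1"
  by (simp add: homogeneous_def mfps_nth_simps)

lemma homogeneous_uminus [simp]: "homogeneous n (- f) \<longleftrightarrow> homogeneous n f"
  by (simp add: homogeneous_def mfps_nth_simps)

lemma homogeneous_sum: "(\<And>i. i \<in> I \<Longrightarrow> homogeneous n (f i)) \<Longrightarrow> homogeneous n (sum f I)"
  unfolding homogeneous_def mfps_nth_sum by (meson sum.not_neutral_contains_not_neutral)

lemma homogeneous_mult: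
  assumes "homogeneous a f" "homogeneous b g"
  shows "homogeneous (a + b) (f * g)"
  unfolding homogeneous_def
proof (intro allI impI)
  fix m assume "mfps_nth (f * g) m \<noteq> 0"
  then obtain A B where "A + B = m" "mfps_nth f A * mfps_nth g B \<noteq> 0"
    unfolding mfps_nth_simps by (auto elim!: sum.not_neutral_contains_not_neutral)
  then have "mfps_nth f A \<noteq> 0" "mfps_nth g B \<noteq> 0" by auto
  then show "size m = a + b"
    using assms \<open>A + B = m\<close> by (auto simp: homogeneous_def)
qed

lemma homogeneous_power: "homogeneous 1 f \<Longrightarrow> homogeneous n (f ^ n)"
  using homogeneous_mult[of 1 f] by (induction n) auto

lemma mfps_nth_euler: "mfps_nth (euler f) m = of_nat (size m) * mfps_nth f m"
  by (simp add: euler_def)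

lemma euler_uminus: "euler (- f) = - euler f"
  by (rule mfps_eqI) (simp add: mfps_nth_euler mfps_nth_simps)

lemma euler_sum: "euler (sum f I) = (\<Sum>i\<in>I. euler (f i))"
  by (rule mfps_eqI) (simp add: mfps_nth_euler mfps_nth_sum sum_distrib_left)

lemma euler_0 [simp]: "euler 0 = 0"
  by (rule mfps_eqI) (simp add: mfps_nth_euler mfps_nth_simps)

lemma euler_1 [simp]: "euler 1 = 0"
  by (rule mfps_eqI) (simp add: mfps_nth_euler mfps_nth_simps)

lemma euler_mult: "euler (f * g) = euler f * g + f * euler g"
proof (rule mfps_eqI)
  fix m
  show "mfps_nth (euler (f * g)) m = mfps_nth (euler f * g + f * euler g) m"
    unfolding mfps_nth_euler mfps_nth_simps sum_distrib_left sum.distrib[symmetric]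
    by (rule sum.cong) (auto simp: algebra_simps)
qed

text \<open>
  Multiplication by a linear form raises the degree by exactly one.  This is why a flow
  \<open>\<theta> F = A F\<close> with linear \<open>A\<close> (\<open>\<theta>\<close> the Euler derivation) determines \<open>F\<close> degree by degree.
\<close>

lemma mfps_nth_linear_mult:
  assumes "homogeneous 1 f" "\<And>B. size m = Suc (size B) \<Longrightarrow> mfps_nth g B = mfps_nth h B"
  shows "mfps_nth (f * g) m = mfps_nth (f * h) m"
  unfolding mfps_nth_simps
proof (rule sum.cong[OF refl], clarify)
  fix A B assume "m = A + B"
  then show "mfps_nth f A * mfps_nth g B = mfps_nth f A * mfps_nth h B"
    using assms by (cases "size A = 1") (auto simp: homogeneousD)
qed

text \<open>
  The Euler derivation multiplies \<open>f\<^sub>n / n!\<close> by \<open>n\<close>, leaving \<open>f\<^sub>n / (n - 1)!\<close>; hence it acts on an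
  exponential of linear operators as the derivative in time acts on \<open>e\<^bsup>tA\<^esup>\<close>.
\<close>

lemma euler_egf:
  assumes "\<And>n. f (Suc n) = (\<Sum>i\<in>I. a i * g i n)" "\<And>i. i \<in> I \<Longrightarrow> homogeneous 1 (a i)"
  shows "euler (egf f) = (\<Sum>i\<in>I. a i * egf (g i))"
proof (rule mfps_eqI)
  fix m
  show "mfps_nth (euler (egf f)) m = mfps_nth (\<Sum>i\<in>I. a i * egf (g i)) m"
  proof (cases "size m")
    case 0
    then show ?thesis
      using homogeneousD[OF assms(2), of _ "{#}"]
      by (simp add: mfps_nth_euler mfps_nth_sum)
  next
    case (Suc n)
    have "mfps_nth (a i * egf (g i)) m = mfps_nth (a i * (mfps_const (1 / fact n) * g i n)) m"
      if "i \<in> I" for i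
      using assms(2)[OF that] by (rule mfps_nth_linear_mult) (simp add: egf_def Suc)
    also have "mfps_nth (a i * (mfps_const (1 / fact n) * g i n)) m = 1 / fact n * mfps_nth (a i * g i n) m" for i
      by (simp only: mult.left_commute[of "a i"] mfps_nth_const_mult)
    finally have "mfps_nth (\<Sum>i\<in>I. a i * egf (g i)) m = 1 / fact n * mfps_nth (f (Suc n)) m"
      by (simp add: mfps_nth_sum assms(1) sum_distrib_left)
    moreover have "mfps_nth (euler (egf f)) m = of_nat (Suc n) / fact (Suc n) * mfps_nth (f (Suc n)) m"
      by (simp add: mfps_nth_euler egf_def Suc)
    moreover have "of_nat (Suc n) / fact (Suc n) = (1 / fact n :: 'b)"
      by (simp add: field_simps del: of_nat_Suc)
    ultimately show ?thesis by simp
  qed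
qed

lemma formal_sum_eq_egf:
  assumes "\<And>n. homogeneous n (f n)"
  shows "formal_sum UNIV (\<lambda>n. mfps_const (1 / fact n) * f n) = egf f"
proof (rule mfps_eqI)
  fix m
  have "(\<Sum>i | i \<in> UNIV \<and> mfps_nth (mfps_const (1 / fact i) * f i) m \<noteq> 0.
      mfps_nth (mfps_const (1 / fact i) * f i) m) =
    (\<Sum>i\<in>{size m}. mfps_nth (mfps_const (1 / fact i) * f i) m)"
  proof (rule sum.mono_neutral_left)
    show "{i \<in> UNIV. mfps_nth (mfps_const (1 / fact i) * f i) m \<noteq> 0} \<subseteq> {size m}"
      using assms by (auto simp: homogeneous_def)
  qed auto
  then show "mfps_nth (formal_sum UNIV (\<lambda>n. mfps_const (1 / fact n) * f n)) m = mfps_nth (egf f) m"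
    by (simp add: formal_sum_def egf_def)
qed

lemma mfps_exp_eq_egf: "homogeneous 1 f \<Longrightarrow> mfps_exp f = egf (\<lambda>n. f ^ n)"
  unfolding mfps_exp_def by (intro formal_sum_eq_egf homogeneous_power)

lemma euler_mfps_exp:
  assumes "homogeneous 1 f"
  shows "euler (mfps_exp f) = f * mfps_exp f"
  using euler_egf[of "\<lambda>n. f ^ n" "\<lambda>_. f" "\<lambda>_ n. f ^ n" "{()}"] assms
  by (simp add: mfps_exp_eq_egf)

lemma mfps_exp_const_term: "homogeneous 1 f \<Longrightarrow> mfps_nth (mfps_exp f) {#} = 1"
  by (simp add: mfps_exp_eq_egf egf_def mfps_nth_simps)

text \<open>
  The product is killed by the Euler derivation, so only its constant term survives.
\<close>

lemma mfps_exp_inverse: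
  assumes "homogeneous 1 (f :: ('v, 'a :: field_char_0) mfps)"
  shows "mfps_exp f * mfps_exp (- f) = 1"
proof (rule mfps_eqI)
  fix m
  have "euler (mfps_exp f * mfps_exp (- f)) = 0"
    using assms by (simp add: euler_mult euler_mfps_exp algebra_simps)
  then have "of_nat (size m) * mfps_nth (mfps_exp f * mfps_exp (- f)) m = 0"
    by (metis mfps_nth_euler mfps_nth_simps(1))
  then show "mfps_nth (mfps_exp f * mfps_exp (- f)) m = mfps_nth 1 m"
    using assms by (auto simp: mfps_nth_simps(2) mfps_exp_const_term)
qed

section \<open>Linear forms in the power sums\<close>

text \<open>
  The series \<open>\<xi>\<close>, \<open>\<Lambda>\<close> and the matrix entries of \<open>H\<^sub>+\<close> all have this form.
\<close>

definition power_sum_form :: "(nat \<Rightarrow> complex) \<Rightarrow> series" where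
  "power_sum_form c = formal_sum {1..} (\<lambda>k. mfps_const (c k / of_nat k) * pvar k)"

lemma formal_sum_eq_sum:
  assumes "finite K" "K \<subseteq> I" "\<And>i. i \<in> I - K \<Longrightarrow> mfps_nth (f i) m = 0"
  shows "mfps_nth (formal_sum I f) m = (\<Sum>i\<in>K. mfps_nth (f i) m)"
  unfolding formal_sum_def mfps_nth_Abs
  by (rule sum.mono_neutral_left) (use assms in auto)

lemma mfps_nth_pvar: "mfps_nth (pvar k) m = (if m = {#k#} then 1 else 0)"
  by (simp add: pvar_def mfps_var_def)

lemma mfps_nth_mult_pvar: "k \<notin># m \<Longrightarrow> mfps_nth (f * pvar k * g) m = 0"
  by (subst mult.commute[of f], subst mult.assoc, unfold mfps_nth_simps(6))
    (auto simp: mfps_nth_pvar intro!: sum.neutral)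

lemma mfps_nth_power_sum_form:
  "mfps_nth (power_sum_form c) m = (\<Sum>k\<in>set_mset m \<inter> {1..}. if m = {#k#} then c k / of_nat k else 0)"
  unfolding power_sum_form_def
  by (subst formal_sum_eq_sum[of "set_mset m \<inter> {1..}"]) (auto simp: mfps_nth_pvar intro!: sum.cong)

lemma homogeneous_power_sum_form: "homogeneous 1 (power_sum_form c)"
  by (auto simp: homogeneous_def mfps_nth_power_sum_form elim!: sum.not_neutral_contains_not_neutral split: if_splits)

lemma power_sum_form_0: "power_sum_form (\<lambda>_. 0) = 0"
  by (rule mfps_eqI) (auto simp: mfps_nth_power_sum_form mfps_nth_simps intro!: sum.neutral)

lemma power_sum_form_uminus: "power_sum_form (\<lambda>k. - c k) = - power_sum_form c"
  by (rule mfps_eqI) (auto simp: mfps_nth_power_sum_form mfps_nth_simps simp flip: sum_negf intro!: sum.cong)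

lemma power_sum_form_sum: "power_sum_form (\<lambda>k. \<Sum>i\<in>I. c i k) = (\<Sum>i\<in>I. power_sum_form (c i))"
  by (rule mfps_eqI, simp add: mfps_nth_power_sum_form mfps_nth_sum, subst sum.swap)
     (auto simp: sum_divide_distrib intro!: sum.cong)

text \<open>
  Exchanges the sum over \<open>k\<close> in \<open>H\<^sub>+\<close> with the sum over pairs of fermions in each current.  A fixed
  monomial \<open>m\<close> only involves the finitely many \<open>k\<close> that occur in \<open>m\<close>, which makes all sums finite.
\<close>

lemma formal_sum_power_sum_mult:
  "formal_sum {1..} (\<lambda>k. mfps_const (1 / of_nat k) * pvar k * (\<Sum>i\<in>I. mfps_const (c i k) * x i)) =
    (\<Sum>i\<in>I. power_sum_form (c i) * x i)"
proof (rule mfps_eqI)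
  fix m :: "nat multiset"
  let ?K = "set_mset m \<inter> {1..}"
  have "mfps_nth (formal_sum {1..} (\<lambda>k. mfps_const (1 / of_nat k) * pvar k * (\<Sum>i\<in>I. mfps_const (c i k) * x i))) m
    = (\<Sum>k\<in>?K. mfps_nth (mfps_const (1 / of_nat k) * pvar k * (\<Sum>i\<in>I. mfps_const (c i k) * x i)) m)"
    by (rule formal_sum_eq_sum) (auto intro: mfps_nth_mult_pvar)
  also have "\<dots> = (\<Sum>k\<in>?K. \<Sum>i\<in>I. mfps_nth (mfps_const (c i k / of_nat k) * pvar k * x i) m)"
  proof (rule sum.cong[OF refl])
    fix k
    have "mfps_const (1 / of_nat k) * pvar k * (mfps_const (c i k) * x i) = mfps_const (c i k / of_nat k) * pvar k * x i" for i
      by (rule mfps_eqI) (simp add: mult.assoc mult.left_commute[of "pvar k" "mfps_const _"])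
    then show "mfps_nth (mfps_const (1 / of_nat k) * pvar k * (\<Sum>i\<in>I. mfps_const (c i k) * x i)) m
      = (\<Sum>i\<in>I. mfps_nth (mfps_const (c i k / of_nat k) * pvar k * x i) m)"
      by (simp only: sum_distrib_left mfps_nth_sum)
  qed
  also have "\<dots> = (\<Sum>i\<in>I. \<Sum>k\<in>?K. mfps_nth (mfps_const (c i k / of_nat k) * pvar k * x i) m)"
    by (rule sum.swap)
  also have "\<dots> = (\<Sum>i\<in>I. mfps_nth (power_sum_form (c i) * x i) m)"
  proof (rule sum.cong[OF refl])
    fix i
    have *: "mfps_nth (power_sum_form (c i)) A = (\<Sum>k\<in>?K. mfps_nth (mfps_const (c i k / of_nat k) * pvar k) A)"
      if "A \<subseteq># m" for A
      unfolding power_sum_form_def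
      by (rule formal_sum_eq_sum) (use set_mset_mono[OF that] in \<open>auto simp: mfps_nth_pvar\<close>)
    define q where "q k = mfps_const (c i k / of_nat k) * pvar k" for k
    have "(\<Sum>k\<in>?K. mfps_nth (q k * x i) m) =
       (\<Sum>(A, B) | A + B = m. \<Sum>k\<in>?K. mfps_nth (q k) A * mfps_nth (x i) B)"
      unfolding mfps_nth_simps(6)
      by (subst sum.swap) (simp add: case_prod_unfold)
    also have "\<dots> = mfps_nth (power_sum_form (c i) * x i) m"
      unfolding mfps_nth_simps(6)
      by (rule sum.cong[OF refl]) (auto simp: * q_def[symmetric] sum_distrib_right)
    finally show "(\<Sum>k\<in>?K. mfps_nth (mfps_const (c i k / of_nat k) * pvar k * x i) m) =
      mfps_nth (power_sum_form (c i) * x i) m"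
      by (simp only: q_def)
  qed
  finally show "mfps_nth (formal_sum {1..} (\<lambda>k. mfps_const (1 / of_nat k) * pvar k * (\<Sum>i\<in>I. mfps_const (c i k) * x i))) m
    = mfps_nth (\<Sum>i\<in>I. power_sum_form (c i) * x i) m"
    by (simp add: mfps_nth_sum)
qed


section \<open>Quadratic operators on the Fock space\<close>

definition upper_linear :: "(int \<Rightarrow> int \<Rightarrow> series) \<Rightarrow> bool" where
  "upper_linear A \<longleftrightarrow> (\<forall>i j. homogeneous 1 (A i j)) \<and> (\<forall>i j. j < i \<longrightarrow> A i j = 0)"

definition box :: "nat \<Rightarrow> int set" where
  "box N = {1 - int N..int N}"

text \<open>
  The normally ordered operator \<open>\<Sum> A\<^sub>i\<^sub>j :\<psi>\<^sub>i \<psi>\<^sub>j\<^sup>*:\<close>, with indices in a box so that the sum is finite.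
  The box is symmetric under \<open>i \<mapsto> 1 - i\<close>, the reflection used by particle-hole duality.
\<close>

definition quadratic :: "(int \<Rightarrow> int \<Rightarrow> series) \<Rightarrow> nat \<Rightarrow> fvec \<Rightarrow> fvec" where
  "quadratic A N v = (\<lambda>S. \<Sum>(i, j)\<in>box N \<times> box N. A i j * normal_ordered i j v S)"

definition basis_vec :: "int set \<Rightarrow> fvec" where
  "basis_vec T = (\<lambda>S. if S = T then 1 else 0)"

definition evolve :: "(int \<Rightarrow> int \<Rightarrow> series) \<Rightarrow> nat \<Rightarrow> int set \<Rightarrow> fvec" where
  "evolve A N T = (\<lambda>S. egf (\<lambda>n. (quadratic A N ^^ n) (basis_vec T) S))"

lemma finite_box [simp]: "finite (box N)"
  by (simp add: box_def)

lemma wedge_sign_cases: "wedge_sign j S \<in> {1, - 1}"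
  by (cases "even (card {s \<in> S. j < s})") (simp_all add: wedge_sign_def)

lemma psi_signed: "\<exists>s\<in>{0, 1, - 1}. \<exists>X. \<forall>v. psi j v S = s * v X"
  using wedge_sign_cases[of j S]
  by (cases "j \<in> S") (force simp: psi_def)+

lemma psi_star_signed: "\<exists>s\<in>{0, 1, - 1}. \<exists>X. \<forall>v. psi_star j v S = s * v X"
  using wedge_sign_cases[of j S]
  by (cases "j \<in> S") (force simp: psi_star_def)+

text \<open>
  A single normally ordered pair sends a basis wedge to zero or to a signed basis wedge, so on
  coefficients it is evaluation at another wedge, up to sign.
\<close>

lemma normal_ordered_signed:
  "\<exists>s\<in>{0, 1, - 1}. \<exists>X. \<forall>v. normal_ordered i j v S = s * v X"
proof (cases "0 < i")
  case True
  obtain s X where s: "s \<in> {0, 1, - 1}" "\<And>v. psi i v S = s * v X"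
    using psi_signed by meson
  obtain t Y where t: "t \<in> {0, 1, - 1}" "\<And>v. psi_star j v X = t * v Y"
    using psi_star_signed by meson
  have "normal_ordered i j v S = (s * t) * v Y" for v
    using True s t by (simp add: normal_ordered_def mult.assoc)
  moreover have "s * t \<in> {0, 1, - 1}"
    using s(1) t(1) by auto
  ultimately show ?thesis by metis
next
  case False
  obtain s X where s: "s \<in> {0, 1, - 1}" "\<And>v. psi_star j v S = s * v X"
    using psi_star_signed by meson
  obtain t Y where t: "t \<in> {0, 1, - 1}" "\<And>v. psi i v X = t * v Y"
    using psi_signed by meson
  have "normal_ordered i j v S = - (s * t) * v Y" for v
    using False s t by (simp add: normal_ordered_def mult.assoc)
  moreover have "- (s * t) \<in> {0, 1, - 1}"
    using s(1) t(1) by auto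
  ultimately show ?thesis by metis
qed

lemma normal_orderedE:
  obtains s X where "s \<in> {0, 1, - 1}" "\<And>v. normal_ordered i j v S = s * v X"
  using normal_ordered_signed by metis

lemma egf_uminus: "egf (\<lambda>n. - f n) = - egf f"
  by (rule mfps_eqI) (simp add: egf_def mfps_nth_simps)

lemma egf_0: "egf (\<lambda>n. 0) = 0"
  by (rule mfps_eqI) (simp add: egf_def mfps_nth_simps)

lemma normal_ordered_egf:
  "normal_ordered i j (\<lambda>S. egf (\<lambda>n. f n S)) S = egf (\<lambda>n. normal_ordered i j (f n) S)"
  by (rule normal_orderedE[of i j S]) (auto simp: egf_uminus egf_0)

lemma euler_evolve:
  assumes "upper_linear A"
  shows "euler (evolve A N T S) = quadratic A N (evolve A N T) S"
proof -
  have "euler (evolve A N T S) = (\<Sum>p\<in>box N \<times> box N. (case p of (i, j) \<Rightarrow> A i j) *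
      egf (\<lambda>n. case p of (i, j) \<Rightarrow> normal_ordered i j ((quadratic A N ^^ n) (basis_vec T)) S))"
    unfolding evolve_def
    by (rule euler_egf) (use assms in \<open>auto simp: quadratic_def upper_linear_def case_prod_unfold\<close>)
  also have "\<dots> = quadratic A N (evolve A N T) S"
    unfolding evolve_def
      quadratic_def[of A N "\<lambda>S. egf (\<lambda>n. (quadratic A N ^^ n) (basis_vec T) S)"]
    by (simp add: case_prod_unfold normal_ordered_egf)
  finally show ?thesis .
qed

lemma evolve_const_term: "mfps_nth (evolve A N T S) {#} = (if S = T then 1 else 0)"
  by (simp add: evolve_def egf_def basis_vec_def mfps_nth_simps)

text \<open>
  The coefficient of \<open>\<theta> F\<close> in degree \<open>d\<close> is \<open>d\<close> times that of \<open>F\<close>, and \<open>A\<close> raises degrees by one: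
  the constant terms determine everything.
\<close>

lemma quadratic_flow_unique:
  assumes A: "upper_linear A"
    and F: "\<And>S. euler (F S) = quadratic A N F S"
    and G: "\<And>S. euler (G S) = quadratic A N G S"
    and init: "\<And>S. mfps_nth (F S) {#} = mfps_nth (G S) {#}"
  shows "F = G"
proof -
  have "\<forall>S. mfps_nth (F S) m = mfps_nth (G S) m" for m
  proof (induction "size m" arbitrary: m rule: less_induct)
    case less
    show ?case
    proof (cases "m = {#}")
      case False
      have no: "mfps_nth (normal_ordered i j F S) B = mfps_nth (normal_ordered i j G S) B"
        if "size m = Suc (size B)" for i j S B
        by (rule normal_orderedE[of i j S])
           (use less[of B] that in \<open>auto simp: mfps_nth_simps(1,5)\<close>)
      have "mfps_nth (euler (F S)) m = mfps_nth (euler (G S)) m" for S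
        unfolding F G quadratic_def mfps_nth_sum case_prod_unfold
        by (intro sum.cong[OF refl] mfps_nth_linear_mult no)
           (use A in \<open>auto simp: upper_linear_def\<close>)
      then show ?thesis
        using False by (simp add: mfps_nth_euler)
    qed (simp add: init)
  qed
  then show ?thesis
    by (auto intro!: mfps_eqI)
qed

lemma basis_vec_fock: "maya T \<Longrightarrow> basis_vec T \<in> fock"
  by (simp add: basis_vec_def fock_def)

section \<open>Wedge products of series of fermions\<close>

text \<open>
  Creation of a particle in a superposition of basis states, written \<open>\<Psi>(w)\<close> in the explanations.
\<close>

definition create :: "nat \<Rightarrow> (int \<Rightarrow> series) \<Rightarrow> fvec \<Rightarrow> fvec" where
  "create N w v = (\<lambda>S. \<Sum>a\<in>box N. w a * psi a v S)"

text \<open>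
  The decomposable vector \<open>w\<^sub>1 \<and> \<dots> \<and> w\<^sub>n \<and> v\<^sub>c \<and> v\<^bsub>c-1\<^esub> \<and> \<dots>\<close>.
\<close>

definition slater :: "nat \<Rightarrow> (int \<Rightarrow> series) list \<Rightarrow> int \<Rightarrow> fvec" where
  "slater N ws c = foldr (create N) ws (basis_vec {..c})"

lemma create_fock:
  assumes "v \<in> fock"
  shows "create N w v \<in> fock"
proof -
  have *: "\<exists>a\<in>box N. psi a v S \<noteq> 0" if "create N w v S \<noteq> 0" for S
    using that unfolding create_def
    by (auto dest!: mult_not_zero elim!: sum.not_neutral_contains_not_neutral)
  have no: "finite {S. psi a v S \<noteq> 0}" "psi a v S \<noteq> 0 \<Longrightarrow> maya S" for a S
    using psi_fock[OF assms, of a] unfolding fock_def by blast+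
  have "finite (\<Union>a\<in>box N. {S. psi a v S \<noteq> 0})"
    using no by auto
  moreover have "{S. create N w v S \<noteq> 0} \<subseteq> (\<Union>a\<in>box N. {S. psi a v S \<noteq> 0})"
    using * by fastforce
  ultimately have "finite {S. create N w v S \<noteq> 0}"
    by (rule finite_subset[rotated])
  then show ?thesis
    using * no(2) unfolding fock_def by fastforce
qed

lemma maya_atMost: "maya {..c}"
proof -
  have "finite ({..c} \<inter> {0<..})" by (rule finite_subset[of _ "{0<..c}"]) auto
  moreover have "finite ({..0} - {..c})" by (rule finite_subset[of _ "{c<..0}"]) auto
  ultimately show ?thesis by (simp add: maya_def)
qed

lemma slater_fock: "slater N ws c \<in> fock"
  by (induction ws) (simp_all add: slater_def basis_vec_fock maya_atMost create_fock)

lemma normal_ordered_eq_psi_psi_star: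
  assumes "v \<in> fock"
  shows "normal_ordered i j v S = psi i (psi_star j v) S - (if i = j \<and> i \<le> 0 then v S else 0)"
proof (cases "0 < i")
  case True
  then show ?thesis by (auto simp: normal_ordered_def)
next
  case False
  moreover have "- psi_star j (psi i v) S = psi i (psi_star j v) S - (if i = j then v S else 0)"
    by (simp add: psi_psi_star[OF assms, of i j S, symmetric])
  ultimately show ?thesis by (simp add: normal_ordered_def)
qed

lemma psi_diff: "psi a (\<lambda>S. u S - v S) S = psi a u S - psi a v S"
  by (simp add: psi_def right_diff_distrib)

text \<open>
  Normal ordering adds only a scalar, which commutes with everything; so this is the commutator
  \<open>[\<psi>\<^sub>i \<psi>\<^sub>j\<^sup>*, \<psi>\<^sub>a] = \<delta>\<^sub>j\<^sub>a \<psi>\<^sub>i\<close>, a consequence of the Clifford relations.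
\<close>

lemma normal_ordered_psi:
  assumes "v \<in> fock"
  shows "normal_ordered i j (psi a v) S = psi a (normal_ordered i j v) S + (if j = a then psi i v S else 0)"
proof -
  have 1: "psi_star j (psi a v) = (\<lambda>S. (if j = a then v S else 0) - psi a (psi_star j v) S)"
  proof
    fix S
    show "psi_star j (psi a v) S = (if j = a then v S else 0) - psi a (psi_star j v) S"
      using psi_psi_star[OF assms, of a j S] by (simp add: eq_diff_eq add.commute eq_commute)
  qed
  have 2: "psi i (psi a (psi_star j v)) S = - psi a (psi i (psi_star j v)) S"
    using psi_psi[OF psi_star_fock[OF assms], of i a j S] by (simp add: eq_neg_iff_add_eq_0)
  have "psi i (psi_star j (psi a v)) S =
      psi i (\<lambda>S. if j = a then v S else 0) S - psi i (psi a (psi_star j v)) S"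
    unfolding 1 psi_diff ..
  moreover have "psi i (\<lambda>S. if j = a then v S else 0) S = (if j = a then psi i v S else 0)"
    by (simp add: psi_def)
  moreover have "normal_ordered i j v =
      (\<lambda>S. psi i (psi_star j v) S - (if i = j \<and> i \<le> 0 then v S else 0))"
    using normal_ordered_eq_psi_psi_star[OF assms] by blast
  moreover have "psi a (\<lambda>S. if i = j \<and> i \<le> 0 then v S else 0) S = (if i = j \<and> i \<le> 0 then psi a v S else 0)"
    by (simp add: psi_def)
  ultimately show ?thesis
    by (simp add: normal_ordered_eq_psi_psi_star[OF psi_fock[OF assms]] 2 psi_diff)
qed

lemma normal_ordered_linear_comb:
  "normal_ordered i j (\<lambda>S. \<Sum>a\<in>I. w a * f a S) S = (\<Sum>a\<in>I. w a * normal_ordered i j (f a) S)"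
  by (rule normal_orderedE[of i j S]) (auto simp: sum_distrib_left mult_ac sum_negf)

lemma psi_linear_comb:
  "psi b (\<lambda>S. \<Sum>a\<in>I. w a * f a S) S = (\<Sum>a\<in>I. w a * psi b (f a) S)"
  by (simp add: psi_def sum_distrib_left mult_ac)

text \<open>
  A quadratic operator acts on a wedge product as a derivation, through the matrix \<open>A\<close> on each factor:
  \<open>[H, \<Psi>(w)] = \<Psi>(A w)\<close>.
\<close>

lemma quadratic_create:
  assumes "v \<in> fock"
  shows "quadratic A N (create N w v) S =
    create N w (quadratic A N v) S + create N (\<lambda>i. \<Sum>j\<in>box N. A i j * w j) v S"
proof -
  have "quadratic A N (create N w v) S = (\<Sum>i\<in>box N. \<Sum>j\<in>box N. \<Sum>a\<in>box N. A i j * w a *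
     (psi a (normal_ordered i j v) S + (if j = a then psi i v S else 0)))"
    unfolding quadratic_def create_def normal_ordered_linear_comb normal_ordered_psi[OF assms]
    by (simp add: sum.cartesian_product[symmetric] sum_distrib_left mult.assoc)
  also have "\<dots> = (\<Sum>i\<in>box N. \<Sum>j\<in>box N. \<Sum>a\<in>box N. A i j * w a * psi a (normal_ordered i j v) S)
      + (\<Sum>i\<in>box N. \<Sum>j\<in>box N. \<Sum>a\<in>box N. A i j * w a * (if j = a then psi i v S else 0))"
    by (simp only: distrib_left sum.distrib)
  also have "(\<Sum>i\<in>box N. \<Sum>j\<in>box N. \<Sum>a\<in>box N. A i j * w a * (if j = a then psi i v S else 0)) =
      (\<Sum>i\<in>box N. \<Sum>j\<in>box N. A i j * w j * psi i v S)"
    by (intro sum.cong refl) (simp add: if_distrib[of "(*) _"] cong: if_cong)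
  also have "\<dots> = create N (\<lambda>i. \<Sum>j\<in>box N. A i j * w j) v S"
    by (simp add: create_def sum_distrib_right)
  also have "(\<Sum>i\<in>box N. \<Sum>j\<in>box N. \<Sum>a\<in>box N. A i j * w a * psi a (normal_ordered i j v) S) =
      (\<Sum>(i, j)\<in>box N \<times> box N. \<Sum>a\<in>box N. w a * (A i j * psi a (normal_ordered i j v) S))"
    by (simp add: sum.cartesian_product[symmetric] mult_ac)
  also have "\<dots> = (\<Sum>a\<in>box N. \<Sum>p\<in>box N \<times> box N. w a * (A (fst p) (snd p) * psi a (normal_ordered (fst p) (snd p) v) S))"
    by (subst sum.swap) (simp add: case_prod_unfold)
  also have "\<dots> = create N w (quadratic A N v) S"
    unfolding quadratic_def create_def case_prod_unfold psi_linear_comb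
    by (simp add: sum_distrib_left)
  finally show ?thesis .
qed

lemma psi_scale: "psi a (\<lambda>S. c * v S) S = c * psi a v S"
  by (simp add: psi_def mult_ac)

lemma psi_add: "psi a (\<lambda>S. u S + v S) S = psi a u S + psi a v S"
  by (simp add: psi_def algebra_simps)

lemma euler_psi: "euler (psi a v S) = psi a (\<lambda>S. euler (v S)) S"
  using wedge_sign_cases[of a S] by (auto simp: psi_def euler_uminus)

text \<open>
  On the vacuum \<open>{..-n}\<close> a pair with \<open>i < j\<close> either contracts an empty position or fills an occupied
  one.  On the diagonal, only the positions \<open>-n < i \<le> 0\<close>, empty here but filled in the vacuum of
  normal ordering, contribute.
\<close>

lemma normal_ordered_vacuum:
  assumes "i \<le> j"
  shows "normal_ordered i j (basis_vec {..- int n}) S =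
    (if i = j \<and> - int n < i \<and> i \<le> 0 then - basis_vec {..- int n} S else 0)"
proof (cases "- int n < j")
  case True
  have "psi_star j (basis_vec {..- int n}) = (\<lambda>S. 0)"
  proof
    fix S
    have "insert j S \<noteq> {..- int n}"
      using True by (metis atMost_iff insertI1 not_le)
    then show "psi_star j (basis_vec {..- int n}) S = 0"
      by (simp add: psi_star_def basis_vec_def)
  qed
  then have "psi i (psi_star j (basis_vec {..- int n})) S = 0"
    by (simp add: psi_def)
  then show ?thesis
    using True by (auto simp: normal_ordered_eq_psi_psi_star basis_vec_fock maya_atMost)
next
  case False
  have "psi i (basis_vec {..- int n}) = (\<lambda>S. 0)"
  proof
    fix S
    have "i \<in> {..- int n}" "i \<notin> S - {i}"
      using False assms by auto
    then have "S - {i} \<noteq> {..- int n}" by metis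
    then show "psi i (basis_vec {..- int n}) S = 0"
      by (simp add: psi_def basis_vec_def)
  qed
  then have "normal_ordered i j (basis_vec {..- int n}) S = 0"
    using False assms by (simp add: normal_ordered_def psi_star_def)
  then show ?thesis
    using False by auto
qed

lemma quadratic_vacuum:
  assumes "upper_linear A" "n \<le> N"
  shows "quadratic A N (basis_vec {..- int n}) S = - (\<Sum>i\<in>{- int n<..0}. A i i) * basis_vec {..- int n} S"
proof -
  let ?v = "basis_vec {..- int n}"
  have "quadratic A N ?v S = (\<Sum>i\<in>box N. \<Sum>j\<in>box N. A i j * normal_ordered i j ?v S)"
    by (simp add: quadratic_def sum.cartesian_product)
  also have "\<dots> = (\<Sum>i\<in>box N. \<Sum>j\<in>box N. if j = i then (if i \<in> {- int n<..0} then - (A i i * ?v S) else 0) else 0)"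
  proof (intro sum.cong refl)
    fix i j
    show "A i j * normal_ordered i j ?v S = (if j = i then (if i \<in> {- int n<..0} then - (A i i * ?v S) else 0) else 0)"
      using assms(1) by (cases "i \<le> j") (auto simp: upper_linear_def normal_ordered_vacuum)
  qed
  also have "\<dots> = (\<Sum>i\<in>box N. if i \<in> {- int n<..0} then - (A i i * ?v S) else 0)"
    by simp
  also have "\<dots> = (\<Sum>i\<in>box N \<inter> {- int n<..0}. - (A i i * ?v S))"
    by (subst sum.inter_restrict) auto
  also have "box N \<inter> {- int n<..0} = {- int n<..0}"
    using assms(2) by (auto simp: box_def)
  finally show ?thesis by (simp add: sum_negf sum_distrib_right)
qed

text \<open>
  If each factor flows by \<open>\<theta> w = A w\<close>, then the Leibniz rule and \<open>[H, \<Psi>(w)] = \<Psi>(A w)\<close> make the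
  wedge product flow by \<open>H\<close>, up to the scalar by which \<open>H\<close> acts on the vacuum.
\<close>

lemma euler_slater:
  assumes A: "upper_linear A" "n \<le> N"
    and "\<And>w i. w \<in> set ws \<Longrightarrow> i \<in> box N \<Longrightarrow> euler (w i) = (\<Sum>j\<in>box N. A i j * w j)"
  shows "euler (slater N ws (- int n) S) = quadratic A N (slater N ws (- int n)) S
     + (\<Sum>i\<in>{- int n<..0}. A i i) * slater N ws (- int n) S"
  using assms(3)
proof (induction ws arbitrary: S)
  case Nil
  have "euler (basis_vec {..- int n} S) = 0" by (simp add: basis_vec_def)
  then show ?case by (simp add: slater_def quadratic_vacuum[OF A])
next
  case (Cons w ws)
  define c where "c = (\<Sum>i\<in>{- int n<..0}. A i i)"
  define v where "v = slater N ws (- int n)"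
  have v: "v \<in> fock" by (simp add: v_def slater_fock)
  have IH: "euler (v S) = quadratic A N v S + c * v S" for S
    using Cons unfolding v_def c_def by simp
  have "euler (create N w v S) = (\<Sum>a\<in>box N. euler (w a) * psi a v S + w a * psi a (\<lambda>S. euler (v S)) S)"
    by (simp add: create_def euler_sum euler_mult euler_psi)
  also have "\<dots> = (\<Sum>a\<in>box N. (\<Sum>j\<in>box N. A a j * w j) * psi a v S)
    + (\<Sum>a\<in>box N. w a * psi a (quadratic A N v) S) + c * (\<Sum>a\<in>box N. w a * psi a v S)"
    using Cons.prems by (simp add: IH psi_add psi_scale sum.distrib sum_distrib_left algebra_simps)
  also have "\<dots> = quadratic A N (create N w v) S + c * create N w v S"
    unfolding quadratic_create[OF v] by (simp add: create_def)
  finally show ?case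
    by (simp add: slater_def v_def c_def)
qed

text \<open>
  In degree zero the factors reduce to the \<open>\<psi>\<^sub>y\<close>.  As \<open>ys\<close> decreases, each \<open>\<psi>\<^sub>y\<close> inserts \<open>y\<close> in front of
  the wedge built so far, so no sign appears.
\<close>

lemma slater_const_term:
  assumes "length ys = length ws" "sorted_wrt (>) ys" "set ys \<subseteq> box N \<inter> {c<..}"
    and "\<And>q a. q < length ws \<Longrightarrow> mfps_nth ((ws ! q) a) {#} = (if a = ys ! q then 1 else 0)"
  shows "mfps_nth (slater N ws c S) {#} = (if S = set ys \<union> {..c} then 1 else 0)"
  using assms
proof (induction ws arbitrary: ys S)
  case Nil
  then show ?case by (simp add: slater_def basis_vec_def mfps_nth_simps)
next
  case (Cons w ws)
  then obtain y ys' where ys: "ys = y # ys'" by (cases ys) auto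
  define v where "v = slater N ws c"
  have w: "mfps_nth (w a) {#} = (if a = y then 1 else 0)" for a
    using Cons.prems(4)[of 0] ys by simp
  have v: "mfps_nth (v S) {#} = (if S = set ys' \<union> {..c} then 1 else 0)" for S
    unfolding v_def
  proof (rule Cons.IH)
    show "mfps_nth ((ws ! q) a) {#} = (if a = ys' ! q then 1 else 0)" if "q < length ws" for q a
      using Cons.prems(4)[of "Suc q"] that by (simp add: ys)
  qed (use Cons.prems ys in auto)
  have "mfps_nth (create N w v S) {#} = (\<Sum>a\<in>box N. if a = y then mfps_nth (psi y v S) {#} else 0)"
    unfolding create_def mfps_nth_sum by (intro sum.cong) (simp_all add: w)
  also have "\<dots> = mfps_nth (psi y v S) {#}"
    using Cons.prems(3) by (simp add: ys)
  also have "\<dots> = (if S = set ys \<union> {..c} then 1 else 0)"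
  proof (cases "S = set ys \<union> {..c}")
    case True
    have "{s \<in> S. y < s} = {}" "y \<in> S" "S - {y} = set ys' \<union> {..c}"
      using Cons.prems(2,3) True by (auto simp: ys)
    then have "wedge_sign y S = 1" "psi y v S = wedge_sign y S * v (set ys' \<union> {..c})"
      unfolding wedge_sign_def psi_def by (simp_all only: card.empty power_0 if_True)
    then show ?thesis using True v by simp
  next
    case False
    then have "y \<notin> S \<or> S - {y} \<noteq> set ys' \<union> {..c}"
      by (auto simp: ys)
    then show ?thesis using False v by (auto simp: psi_def mfps_nth_simps)
  qed
  finally show ?case by (simp add: slater_def v_def)
qed

lemma slater_support: "slater N ws c S \<noteq> 0 \<Longrightarrow> {..c} \<subseteq> S"
proof (induction ws arbitrary: S)
  case Nil
  then show ?case by (simp add: slater_def basis_vec_def split: if_splits)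
next
  case (Cons w ws)
  then obtain a where "psi a (slater N ws c) S \<noteq> 0"
    by (auto simp: slater_def create_def dest!: mult_not_zero elim!: sum.not_neutral_contains_not_neutral)
  then have "slater N ws c (S - {a}) \<noteq> 0"
    by (auto simp: psi_def split: if_splits)
  then show ?case using Cons.IH by blast
qed



section \<open>Coefficients of a wedge product as determinants\<close>

text \<open>
  Induction on the number of factors by Laplace expansion along the row of the first one: extracting
  \<open>\<psi>\<^bsub>x p\<^esub>\<close> from the wedge of the decreasing sequence \<open>x\<close> costs the sign \<open>(-1)\<^sup>p\<close> of the cofactor, and
  leaves the sequence with its entry number \<open>p\<close> deleted.
\<close>

lemma slater_eq_det:
  assumes "\<And>p q. p < q \<Longrightarrow> q < length ws \<Longrightarrow> x q < x p"
    and "\<And>p. p < length ws \<Longrightarrow> x p \<in> box N \<inter> {c<..}"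
  shows "slater N ws c (x ` {..<length ws} \<union> {..c}) =
    det (mat (length ws) (length ws) (\<lambda>(q, p). (ws ! q) (x p)))"
  using assms
proof (induction ws arbitrary: x)
  case Nil
  then show ?case by (simp add: slater_def basis_vec_def)
next
  case (Cons w ws)
  define n where "n = length ws"
  define S where "S = x ` {..<Suc n} \<union> {..c}"
  define v where "v = slater N ws c"
  define M where "M = mat (Suc n) (Suc n) (\<lambda>(q, p). ((w # ws) ! q) (x p))"
  have mono: "x q < x p \<longleftrightarrow> p < q" if "p < Suc n" "q < Suc n" for p q
    using Cons.prems(1)[of p q] Cons.prems(1)[of q p] that
    by (cases p q rule: linorder_cases) (auto simp: n_def)
  have inj: "inj_on x {..<Suc n}"
  proof (rule inj_onI)
    fix p q assume "p \<in> {..<Suc n}" "q \<in> {..<Suc n}" "x p = x q"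
    then show "p = q"
      using mono[of p q] mono[of q p] by (cases p q rule: linorder_cases) auto
  qed
  have x: "x p \<in> box N" "c < x p" if "p < Suc n" for p
    using Cons.prems(2) that by (auto simp: n_def)
  have minor: "psi (x p) v S = cofactor M 0 p" if p: "p < Suc n" for p
  proof -
    define x' where "x' = x \<circ> insert_index p"
    have img: "insert_index p ` {..<n} = {..<Suc n} - {p}"
      using p insert_index_image[of p n] by (simp add: atLeast0LessThan)
    have "S - {x p} = x' ` {..<n} \<union> {..c}"
    proof -
      have "x ` ({..<Suc n} - {p}) = x ` {..<Suc n} - {x p}"
        using inj p by (simp add: inj_on_image_set_diff)
      then have "x' ` {..<n} = x ` {..<Suc n} - {x p}"
        unfolding x'_def image_comp[symmetric] img .
      moreover have "{..c} - {x p} = {..c}"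
        using x(2)[OF p] by auto
      ultimately show ?thesis
        by (simp only: S_def Un_Diff)
    qed
    moreover have "slater N ws c (x' ` {..<length ws} \<union> {..c}) =
        det (mat (length ws) (length ws) (\<lambda>(q, r). (ws ! q) (x' r)))"
    proof (rule Cons.IH)
      have lt: "insert_index p r < Suc n" if "r < n" for r
        using that by (simp add: insert_index_def)
      show "x' r < x' s" if "s < r" "r < length ws" for r s
        using that lt mono by (auto simp: x'_def n_def insert_index_def)
      show "x' r \<in> box N \<inter> {c<..}" if "r < length ws" for r
        using x lt that by (simp add: x'_def n_def)
    qed
    moreover have "mat_delete M 0 p = mat n n (\<lambda>(q, r). (ws ! q) (x' r))"
      by (rule eq_matI) (auto simp: mat_delete_def M_def x'_def insert_index_def)
    moreover have "wedge_sign (x p) S = (- 1) ^ p"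
    proof -
      have "{s \<in> S. x p < s} = x ` {..<p}"
        using p mono x(2)[OF p] by (auto simp: S_def)
      moreover have "inj_on x {..<p}"
        using inj p by (auto intro: inj_on_subset)
      ultimately have "card {s \<in> S. x p < s} = p"
        by (simp only: card_image) simp
      then show ?thesis by (simp only: wedge_sign_def)
    qed
    ultimately show ?thesis
      using p by (simp add: psi_def v_def n_def cofactor_def S_def)
  qed
  have "create N w v S = (\<Sum>a\<in>x ` {..<Suc n}. w a * psi a v S)"
    unfolding create_def
  proof (rule sum.mono_neutral_right)
    show "\<forall>a\<in>box N - x ` {..<Suc n}. w a * psi a v S = 0"
    proof
      fix a assume a: "a \<in> box N - x ` {..<Suc n}"
      show "w a * psi a v S = 0"
      proof (cases "a \<le> c")
        case True
        \<comment> \<open>Every wedge of \<open>v\<close> contains \<open>{..c}\<close>, so \<open>a\<close> is not what the first factor added.\<close>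
        then have "v (S - {a}) = 0"
          using slater_support[of N ws c "S - {a}"] by (auto simp: v_def)
        then show ?thesis by (simp add: psi_def)
      next
        case False
        then have "a \<notin> S" using a by (auto simp: S_def)
        then show ?thesis by (simp add: psi_def)
      qed
    qed
  qed (use x in auto)
  also have "\<dots> = (\<Sum>p<Suc n. w (x p) * psi (x p) v S)"
    using inj by (subst sum.reindex) (auto simp: comp_def)
  also have "\<dots> = (\<Sum>p<Suc n. M $$ (0, p) * cofactor M 0 p)"
    by (rule sum.cong) (simp_all add: minor M_def)
  also have "\<dots> = det M"
    by (rule laplace_expansion_row[symmetric]) (simp_all add: M_def)
  finally show ?case
    by (simp add: slater_def v_def S_def M_def n_def)
qed

section \<open>Exponentials of triangular matrices\<close>

text \<open>
  Powers of an infinite upper triangular matrix: an entry of a product is a sum over the finite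
  interval between its two indices.
\<close>

fun tri_power :: "(int \<Rightarrow> int \<Rightarrow> series) \<Rightarrow> nat \<Rightarrow> int \<Rightarrow> int \<Rightarrow> series" where
  "tri_power A 0 a b = (if a = b then 1 else 0)"
| "tri_power A (Suc n) a b = (\<Sum>c\<in>{a..b}. A a c * tri_power A n c b)"

definition tri_exp :: "(int \<Rightarrow> int \<Rightarrow> series) \<Rightarrow> int \<Rightarrow> int \<Rightarrow> series" where
  "tri_exp A a b = egf (\<lambda>n. tri_power A n a b)"

lemma tri_exp_lower: "b < a \<Longrightarrow> tri_exp A a b = 0"
proof -
  assume "b < a"
  then have "tri_power A n a b = 0" for n by (cases n) auto
  then show ?thesis by (simp add: tri_exp_def egf_0)
qed

lemma euler_tri_exp:
  assumes "upper_linear A" "a \<in> box N" "b \<in> box N"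
  shows "euler (tri_exp A a b) = (\<Sum>c\<in>box N. A a c * tri_exp A c b)"
proof -
  have "euler (tri_exp A a b) = (\<Sum>c\<in>{a..b}. A a c * tri_exp A c b)"
    unfolding tri_exp_def by (rule euler_egf) (use assms in \<open>auto simp: upper_linear_def\<close>)
  also have "\<dots> = (\<Sum>c\<in>box N. A a c * tri_exp A c b)"
    using assms by (intro sum.mono_neutral_left) (auto simp: box_def upper_linear_def tri_exp_lower not_le)
  finally show ?thesis .
qed

lemma tri_exp_const_term: "mfps_nth (tri_exp A a b) {#} = (if a = b then 1 else 0)"
  by (simp add: tri_exp_def egf_def mfps_nth_simps)

lemma homogeneous_diag_sum: "upper_linear A \<Longrightarrow> homogeneous 1 (\<Sum>i\<in>I. A i i)"
  by (rule homogeneous_sum) (auto simp: upper_linear_def)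

text \<open>
  The heart of the matter.  The columns of \<open>e\<^sup>A\<close> flow by \<open>\<theta> w = A w\<close>, so their wedge product,
  multiplied by the exponential of the eigenvalue of \<open>H\<close> on the vacuum, flows by \<open>H\<close>; it has the same
  constant term as \<open>e\<^sup>H |y\<rangle>\<close>, hence equals it.  The coefficients of the wedge product are the minors of
  \<open>e\<^sup>A\<close>.
\<close>

theorem evolve_eq_det:
  assumes A: "upper_linear A" and n: "n \<le> N"
    and x: "\<And>p q. p < q \<Longrightarrow> q < n \<Longrightarrow> x q < x p" "\<And>p. p < n \<Longrightarrow> x p \<in> box N \<inter> {- int n<..}"
    and y: "\<And>p q. p < q \<Longrightarrow> q < n \<Longrightarrow> y q < y p" "\<And>p. p < n \<Longrightarrow> y p \<in> box N \<inter> {- int n<..}"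
  shows "evolve A N (y ` {..<n} \<union> {..- int n}) (x ` {..<n} \<union> {..- int n}) =
    mfps_exp (- (\<Sum>i\<in>{- int n<..0}. A i i)) * det (mat n n (\<lambda>(q, p). tri_exp A (x p) (y q)))"
proof -
  define c where "c = (\<Sum>i\<in>{- int n<..0}. A i i)"
  define ws where "ws = map (\<lambda>q a. tri_exp A a (y q)) [0..<n]"
  define v where "v = slater N ws (- int n)"
  let ?T = "y ` {..<n} \<union> {..- int n}"
  have c: "homogeneous 1 (- c)"
    unfolding c_def homogeneous_uminus by (rule homogeneous_diag_sum[OF A])
  have v: "euler (v S) = quadratic A N v S + c * v S" for S
    unfolding v_def c_def
  proof (rule euler_slater[OF A n])
    fix w i assume "w \<in> set ws" "i \<in> box N"
    then show "euler (w i) = (\<Sum>j\<in>box N. A i j * w j)"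
      using y(2) by (auto simp: ws_def euler_tri_exp[OF A])
  qed
  have v0: "mfps_nth (v S) {#} = (if S = ?T then 1 else 0)" for S
  proof -
    have "mfps_nth (v S) {#} = (if S = set (map y [0..<n]) \<union> {..- int n} then 1 else 0)"
      unfolding v_def
    proof (rule slater_const_term)
      show "sorted_wrt (>) (map y [0..<n])"
        using y(1) by (auto simp: sorted_wrt_iff_nth_less)
    qed (use y(2) in \<open>auto simp: ws_def tri_exp_const_term\<close>)
    then show ?thesis by (simp add: atLeast0LessThan)
  qed
  have "evolve A N ?T = (\<lambda>S. mfps_exp (- c) * v S)"
  proof (rule quadratic_flow_unique[OF A])
    fix S
    show "euler (evolve A N ?T S) = quadratic A N (evolve A N ?T) S"
      by (rule euler_evolve[OF A])
    have "quadratic A N (\<lambda>S. mfps_exp (- c) * v S) S = mfps_exp (- c) * quadratic A N v S"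
      using normal_ordered_linear_comb[where I = "{()}" and w = "\<lambda>_. mfps_exp (- c)" and f = "\<lambda>_. v" and S = S]
      by (simp add: quadratic_def sum_distrib_left case_prod_unfold mult_ac)
    then show "euler (mfps_exp (- c) * v S) = quadratic A N (\<lambda>S. mfps_exp (- c) * v S) S"
      by (simp add: euler_mult euler_mfps_exp[OF c] v algebra_simps)
    show "mfps_nth (evolve A N ?T S) {#} = mfps_nth (mfps_exp (- c) * v S) {#}"
      by (simp add: evolve_const_term mfps_exp_const_term[OF c] v0)
  qed
  moreover have "v (x ` {..<n} \<union> {..- int n}) = det (mat n n (\<lambda>(q, p). tri_exp A (x p) (y q)))"
  proof -
    have "length ws = n" by (simp add: ws_def)
    moreover have "mat n n (\<lambda>(q, p). (ws ! q) (x p)) = mat n n (\<lambda>(q, p). tri_exp A (x p) (y q))"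
      by (rule eq_matI) (auto simp: ws_def)
    ultimately show ?thesis
      using slater_eq_det[of ws x N "- int n"] x by (simp add: v_def)
  qed
  ultimately show ?thesis by (simp add: c_def)
qed



section \<open>Reduction of the currents to finite sums\<close>

definition current_matrix :: "(int \<Rightarrow> complex) \<Rightarrow> (int \<Rightarrow> complex) \<Rightarrow> int \<Rightarrow> int \<Rightarrow> series" where
  "current_matrix \<alpha> \<beta> i j = power_sum_form (\<lambda>k. current_coeff \<alpha> \<beta> k i j)"

lemma upper_linear_current_matrix: "upper_linear (current_matrix \<alpha> \<beta>)"
  unfolding upper_linear_def current_matrix_def
  by (simp add: homogeneous_power_sum_form[simplified] current_coeff_def power_sum_form_0)

lemma current_matrix_diag: "current_matrix \<alpha> \<beta> i i = xi (\<beta> i)"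
  by (simp add: current_matrix_def current_coeff_def power_sum_form_def xi_def)

text \<open>
  Vectors spanned by wedges which agree with the vacuum outside \<open>{1 - N..N}\<close>.  This property is
  stable under the flow, which only lowers particles and is blocked by the filled positions.
\<close>

definition box_supported :: "nat \<Rightarrow> fvec \<Rightarrow> bool" where
  "box_supported N v \<longleftrightarrow> (\<forall>S. v S \<noteq> 0 \<longrightarrow> {..- int N} \<subseteq> S \<and> S \<subseteq> {..int N})"

text \<open>
  Which wedges \<open>X\<close> can contribute to the coefficient at \<open>S\<close>; the split at \<open>i = 0\<close> reflects normal ordering.
\<close>

lemma normal_ordered_nonzero:
  assumes "normal_ordered i j v S \<noteq> 0"
  obtains X where "v X \<noteq> 0" "X - {i, j} = S - {i, j}"
    "0 < i \<longrightarrow> j \<in> X" "i \<le> 0 \<longrightarrow> i \<notin> X" "i = j \<or> j \<in> X"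
proof (cases "0 < i")
  case True
  then have "v (insert j (S - {i})) \<noteq> 0"
    using assms by (auto simp: normal_ordered_def psi_def psi_star_def split: if_splits)
  then show ?thesis
    using True by (intro that[of "insert j (S - {i})"]) auto
next
  case False
  then have "v (insert j S - {i}) \<noteq> 0"
    using assms by (auto simp: normal_ordered_def psi_def psi_star_def split: if_splits)
  then show ?thesis
    using False by (intro that[of "insert j S - {i}"]) auto
qed

text \<open>
  If \<open>i > 0\<close>, a contributing wedge has a particle at \<open>j\<close>, so \<open>0 < i \<le> j \<le> N\<close>.  If \<open>i \<le> 0\<close>, it has a hole at
  \<open>i\<close>, so \<open>-N < i\<close>, and \<open>j\<close> is either equal to \<open>i\<close> or the position of a particle.
\<close>

lemma normal_ordered_outside_box:
  assumes "box_supported N v" "i \<le> j" "i \<notin> box N \<or> j \<notin> box N"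
  shows "normal_ordered i j v S = 0"
proof (rule ccontr)
  assume "normal_ordered i j v S \<noteq> 0"
  then obtain X where X: "v X \<noteq> 0"
    "0 < i \<longrightarrow> j \<in> X" "i \<le> 0 \<longrightarrow> i \<notin> X" "i = j \<or> j \<in> X"
    by (rule normal_ordered_nonzero)
  then have "{..- int N} \<subseteq> X" "X \<subseteq> {..int N}"
    using assms(1) by (auto simp: box_supported_def)
  then have "i \<le> - int N \<Longrightarrow> i \<in> X" "j \<in> X \<Longrightarrow> j \<le> int N"
    by auto
  then show False
    using X assms(2,3) by (cases "0 < i"; cases "i = j") (auto simp: box_def)
qed

lemma box_supported_quadratic:
  assumes "box_supported N v"
  shows "box_supported N (quadratic A N v)"
  unfolding box_supported_def
proof (intro allI impI)
  fix S assume "quadratic A N v S \<noteq> 0"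
  then obtain i j where ij: "i \<in> box N" "j \<in> box N" "normal_ordered i j v S \<noteq> 0"
    unfolding quadratic_def
    by (auto dest!: mult_not_zero elim!: sum.not_neutral_contains_not_neutral)
  obtain X where X: "v X \<noteq> 0" "X - {i, j} = S - {i, j}"
    using ij(3) by (rule normal_ordered_nonzero)
  then have bd: "{..- int N} \<subseteq> X" "X \<subseteq> {..int N}"
    using assms by (auto simp: box_supported_def)
  have same: "s \<in> S \<longleftrightarrow> s \<in> X" if "s \<noteq> i" "s \<noteq> j" for s
    using X(2) that by blast
  show "{..- int N} \<subseteq> S \<and> S \<subseteq> {..int N}"
  proof (intro conjI subsetI)
    fix s assume s: "s \<in> {..- int N}"
    then have "s \<noteq> i" "s \<noteq> j" using ij by (auto simp: box_def)
    then show "s \<in> S" using same bd(1) s by blast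
  next
    fix s assume s: "s \<in> S"
    show "s \<in> {..int N}"
    proof (cases "s = i \<or> s = j")
      case True
      then show ?thesis using ij by (auto simp: box_def)
    next
      case False
      then have "s \<in> X" using same s by blast
      then show ?thesis using bd(2) by blast
    qed
  qed
qed

lemma formal_sum_finite:
  assumes "finite K" "K \<subseteq> I" "\<And>i. i \<in> I - K \<Longrightarrow> f i = 0"
  shows "formal_sum I f = sum f K"
proof (rule mfps_eqI)
  fix m
  show "mfps_nth (formal_sum I f) m = mfps_nth (sum f K) m"
    unfolding mfps_nth_sum by (rule formal_sum_eq_sum) (use assms in \<open>simp_all add: mfps_nth_simps(1)\<close>)
qed

lemma H_plus_eq_quadratic:
  assumes "box_supported N v"
  shows "H_plus \<alpha> \<beta> v = quadratic (current_matrix \<alpha> \<beta>) N v"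
proof
  fix S
  have const_0: "mfps_const 0 = (0 :: series)"
    by (rule mfps_eqI) (simp add: mfps_const_def mfps_nth_simps)
  have "current \<alpha> \<beta> k v S = (\<Sum>p\<in>box N \<times> box N.
      mfps_const (current_coeff \<alpha> \<beta> k (fst p) (snd p)) * normal_ordered (fst p) (snd p) v S)" for k
    unfolding current_def case_prod_unfold
  proof (rule formal_sum_finite)
    fix p assume p: "p \<in> UNIV - box N \<times> box N"
    show "mfps_const (current_coeff \<alpha> \<beta> k (fst p) (snd p)) * normal_ordered (fst p) (snd p) v S = 0"
    proof (cases "fst p \<le> snd p")
      case True
      then have "normal_ordered (fst p) (snd p) v S = 0"
        using p by (intro normal_ordered_outside_box[OF assms]) (auto simp: mem_Times_iff)
      then show ?thesis by simp
    qed (simp add: current_coeff_def const_0)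
  qed simp_all
  then show "H_plus \<alpha> \<beta> v S = quadratic (current_matrix \<alpha> \<beta>) N v S"
    unfolding H_plus_def quadratic_def current_matrix_def case_prod_unfold
    by (simp only: formal_sum_power_sum_mult)
qed

lemma homogeneous_quadratic_power:
  assumes "upper_linear A"
  shows "homogeneous n ((quadratic A N ^^ n) (basis_vec T) S)"
proof (induction n arbitrary: S)
  case 0
  then show ?case by (simp add: basis_vec_def)
next
  case (Suc n)
  have "homogeneous n (normal_ordered i j ((quadratic A N ^^ n) (basis_vec T)) S)" for i j S
    by (rule normal_orderedE[of i j S]) (use Suc in auto)
  then have "homogeneous (1 + n) (A i j * normal_ordered i j ((quadratic A N ^^ n) (basis_vec T)) S)" for i j
    by (intro homogeneous_mult) (use assms in \<open>auto simp: upper_linear_def\<close>)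
  then show ?case
    by (auto simp: quadratic_def[of A N "(quadratic A N ^^ n) (basis_vec T)"] intro!: homogeneous_sum)
qed

lemma exp_H_plus_eq_evolve:
  assumes "box_supported N (basis_vec T)"
  shows "exp_H_plus \<alpha> \<beta> (basis_vec T) = evolve (current_matrix \<alpha> \<beta>) N T"
proof -
  let ?A = "current_matrix \<alpha> \<beta>"
  have box_supported: "box_supported N ((quadratic ?A N ^^ n) (basis_vec T))" for n
    by (induction n) (simp_all add: assms box_supported_quadratic)
  have "(H_plus \<alpha> \<beta> ^^ n) (basis_vec T) = (quadratic ?A N ^^ n) (basis_vec T)" for n
    by (induction n) (simp_all add: H_plus_eq_quadratic[OF box_supported])
  then show ?thesis
    unfolding exp_H_plus_def evolve_def
    by (simp only: formal_sum_eq_egf homogeneous_quadratic_power upper_linear_current_matrix)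
qed

section \<open>Particle-hole duality\<close>

text \<open>
  The reflection \<open>s \<mapsto> 1 - s\<close> turns the complement of a wedge set into a wedge set, and fixes the vacuum
  \<open>{..0}\<close>.  On partitions it is conjugation.
\<close>

definition holes :: "int set \<Rightarrow> int set" where
  "holes S = {s. 1 - s \<notin> S}"

text \<open>
  The matrix by which holes move: when a particle hops from \<open>j\<close> to \<open>i\<close>, the hole hops from \<open>i\<close> to \<open>j\<close>.
  This is the reflected transpose of \<open>-A\<close>, conjugated by the diagonal matrix of the signs \<open>(-1)\<^sup>i\<close>.
\<close>

definition hole_dual :: "(int \<Rightarrow> int \<Rightarrow> series) \<Rightarrow> int \<Rightarrow> int \<Rightarrow> series" where
  "hole_dual A i j = (if even (j - i) then - A (1 - j) (1 - i) else A (1 - j) (1 - i))"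

lemma mem_holes: "s \<in> holes S \<longleftrightarrow> 1 - s \<notin> S"
  by (simp add: holes_def)

lemma holes_holes [simp]: "holes (holes S) = S"
  by (simp add: holes_def)

lemma holes_eq_iff [simp]: "holes S = holes T \<longleftrightarrow> S = T"
  by (metis holes_holes)

lemma upper_linear_hole_dual: "upper_linear A \<Longrightarrow> upper_linear (hole_dual A)"
  by (auto simp: upper_linear_def hole_dual_def)

lemma maya_holes:
  assumes "maya S"
  shows "maya (holes S)"
proof -
  have "holes S \<inter> {0<..} \<subseteq> (\<lambda>s. 1 - s) ` ({..0} - S)"
  proof
    fix x assume "x \<in> holes S \<inter> {0<..}"
    then show "x \<in> (\<lambda>s. 1 - s) ` ({..0} - S)"
      by (intro image_eqI[of _ _ "1 - x"]) (auto simp: holes_def)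
  qed
  moreover have "{..0} - holes S \<subseteq> (\<lambda>s. 1 - s) ` (S \<inter> {0<..})"
  proof
    fix x assume "x \<in> {..0} - holes S"
    then show "x \<in> (\<lambda>s. 1 - s) ` (S \<inter> {0<..})"
      by (intro image_eqI[of _ _ "1 - x"]) (auto simp: holes_def)
  qed
  ultimately show ?thesis
    using assms unfolding maya_def by (meson finite_imageI finite_subset)
qed

lemma wedge_sign_mult:
  assumes "maya S" "i < j" "j \<notin> S"
  shows "wedge_sign i S * wedge_sign j S = (- 1) ^ card (S \<inter> {i<..<j})"
proof -
  have "{s \<in> S. i < s} = S \<inter> {i<..<j} \<union> {s \<in> S. j < s}"
    using assms(2,3) by (auto simp: not_le order_le_less) (metis linorder_neqE)
  moreover have "card (S \<inter> {i<..<j} \<union> {s \<in> S. j < s}) = card (S \<inter> {i<..<j}) + card {s \<in> S. j < s}"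
    by (rule card_Un_disjoint) (use maya_finite_above[OF assms(1)] in auto)
  ultimately have "wedge_sign i S = (- 1) ^ card (S \<inter> {i<..<j}) * wedge_sign j S"
    by (simp only: wedge_sign_def power_add)
  then show ?thesis
    using wedge_sign_square[of j S 1] by (simp add: mult.assoc)
qed

text \<open>
  For \<open>i < j\<close> the normal ordering is immaterial, and the sign counts the particles jumped over.
\<close>

lemma normal_ordered_hop:
  assumes "maya S" "i < j"
  shows "normal_ordered i j v S =
    (if i \<in> S \<and> j \<notin> S then (- 1) ^ card (S \<inter> {i<..<j}) * v (insert j (S - {i})) else 0)"
proof (cases "i \<in> S \<and> j \<notin> S")
  case True
  have ins: "insert j S - {i} = insert j (S - {i})" using assms(2) by auto
  have 1: "wedge_sign i S * (wedge_sign j S * x) = (- 1) ^ card (S \<inter> {i<..<j}) * x" for x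
    using wedge_sign_mult[OF assms conjunct2[OF True]] by (simp only: mult.assoc[symmetric])
  have 2: "wedge_sign j S * (wedge_sign i S * x) = (- 1) ^ card (S \<inter> {i<..<j}) * x" for x
    by (subst mult.left_commute) (rule 1)
  show ?thesis
    using True assms
    by (auto simp: normal_ordered_def psi_def psi_star_def wedge_sign_remove wedge_sign_insert ins 1 2)
next
  case False
  then show ?thesis
    using assms(2) by (auto simp: normal_ordered_def psi_def psi_star_def)
qed

lemma normal_ordered_diag:
  "normal_ordered i i v S =
    (if 0 < i then (if i \<in> S then v S else 0) else (if i \<in> S then 0 else - v S))"
  by (auto simp: normal_ordered_def psi_def psi_star_def insert_absorb)

text \<open>
  The \<open>j - i - 1\<close> positions strictly between \<open>i\<close> and \<open>j\<close> are either particles or holes, so the sign of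
  the hop seen by particles and the one seen by holes differ by \<open>(-1)\<^bsup>j-i-1\<^esup>\<close>.  On the diagonal,
  normal ordering exchanges the two cases with a sign.
\<close>

lemma normal_ordered_holes:
  assumes S: "maya S" "i \<le> j" and v: "\<And>X. maya X \<Longrightarrow> v' (holes X) = v X"
  shows "normal_ordered (1 - j) (1 - i) v' (holes S) =
    (if even (j - i) then - normal_ordered i j v S else normal_ordered i j v S)"
proof (cases "i = j")
  case True
  then show ?thesis
    using v[OF S(1)] by (auto simp: normal_ordered_diag holes_def)
next
  case False
  then have "i < j" using S(2) by simp
  let ?c = "card (S \<inter> {i<..<j})" and ?d = "card (holes S \<inter> {1 - j<..<1 - i})"
  have "?d = card ({i<..<j} - S)"
    by (rule bij_betw_same_card[of "\<lambda>s. 1 - s"])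
      (rule bij_betw_byWitness[of _ "\<lambda>s. 1 - s"], auto simp: holes_def)
  moreover have "card ({i<..<j} - S) + ?c = card {i<..<j}"
    using card_Diff_subset_Int[of "{i<..<j}" S] card_mono[of "{i<..<j}" "S \<inter> {i<..<j}"]
    by (simp add: Int_commute)
  ultimately have "?d + ?c = nat (j - i - 1)" by simp
  then have parity: "even (j - i) \<longleftrightarrow> odd (?d + ?c)"
    using \<open>i < j\<close> by (simp add: even_nat_iff)
  have "insert (1 - i) (holes S - {1 - j}) = holes (insert j (S - {i}))"
    using \<open>i < j\<close> by (auto simp: holes_def)
  then have "normal_ordered (1 - j) (1 - i) v' (holes S) =
      (if i \<in> S \<and> j \<notin> S then (- 1) ^ ?d * v (insert j (S - {i})) else 0)"
    using normal_ordered_hop[OF maya_holes[OF S(1)], of "1 - j" "1 - i" v']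
      v[of "insert j (S - {i})"] S(1) \<open>i < j\<close> by (simp add: mem_holes conj_commute)
  moreover have "(- 1) ^ ?d = (if even (j - i) then - ((- 1) ^ ?c) else (- 1) ^ ?c :: series)"
    using parity by (auto simp: minus_one_power_iff)
  ultimately show ?thesis
    by (simp add: normal_ordered_hop[OF S(1) \<open>i < j\<close>])
qed

lemma quadratic_holes:
  assumes A: "upper_linear A" and S: "maya S" and v: "\<And>X. maya X \<Longrightarrow> v' (holes X) = v X"
  shows "quadratic (hole_dual A) N v' (holes S) = quadratic A N v S"
  unfolding quadratic_def
proof (rule sum.reindex_bij_witness[where i = "\<lambda>(i, j). (1 - j, 1 - i)" and j = "\<lambda>(i, j). (1 - j, 1 - i)"])
  fix p assume "p \<in> box N \<times> box N"
  obtain i j where p: "p = (i, j)" by (cases p)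
  show "(case case p of (i, j) \<Rightarrow> (1 - j, 1 - i) of (i, j) \<Rightarrow> A i j * normal_ordered i j v S) =
    (case p of (i, j) \<Rightarrow> hole_dual A i j * normal_ordered i j v' (holes S))"
  proof (cases "i \<le> j")
    case True
    then show ?thesis
      using normal_ordered_holes[where v' = v' and v = v, OF S _ v, of "1 - j" "1 - i"]
      by (simp add: p hole_dual_def)
  next
    case False
    then show ?thesis using A by (simp add: p hole_dual_def upper_linear_def)
  qed
qed (auto simp: box_def)

lemma evolve_holes:
  assumes "upper_linear A" "maya S"
  shows "evolve (hole_dual A) N (holes T) (holes S) = evolve A N T S"
proof -
  have "maya S \<Longrightarrow> (quadratic (hole_dual A) N ^^ n) (basis_vec (holes T)) (holes S) =
      (quadratic A N ^^ n) (basis_vec T) S" for n S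
    by (induction n arbitrary: S) (simp_all add: basis_vec_def quadratic_holes[OF assms(1)])
  then show ?thesis
    using assms(2) by (simp add: evolve_def)
qed


section \<open>Translation of the indices\<close>

lemma tri_exp_shift: "tri_exp (\<lambda>i j. A (i + a) (j + a)) i j = tri_exp A (i + a) (j + a)"
proof -
  have "tri_power (\<lambda>i j. A (i + a) (j + a)) n i j = tri_power A n (i + a) (j + a)" for n
  proof (induction n arbitrary: i)
    case (Suc n)
    then show ?case
      by (auto intro!: sum.reindex_bij_witness[where i = "\<lambda>c. c - a" and j = "\<lambda>c. c + a"])
  qed simp
  then show ?thesis by (simp add: tri_exp_def)
qed

lemma elem_sym_shift:
  fixes a :: int
  shows "elem_sym r {i..j} (\<lambda>l. x (l + a)) = elem_sym r {i + a..j + a} x"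
  unfolding elem_sym_def
  by (rule sum.reindex_bij_witness[where i = "\<lambda>X. (\<lambda>l. l - a) ` X" and j = "\<lambda>X. (\<lambda>l. l + a) ` X"])
    (auto simp: image_image card_image inj_on_def prod.reindex)

lemma comp_sym_shift:
  fixes a :: int
  shows "comp_sym s {i..j} (\<lambda>l. x (l + a)) = comp_sym s {i + a..j + a} x"
  unfolding comp_sym_def
  by (rule sum.reindex_bij_witness[where i = "image_mset (\<lambda>l. l - a)" and j = "image_mset (\<lambda>l. l + a)"])
    (auto simp: multisets_of_size_def image_mset.compositionality comp_def subset_iff)

lemma current_matrix_shift:
  "current_matrix (shift a \<alpha>) (shift a \<beta>) i j = current_matrix \<alpha> \<beta> (i + a) (j + a)"
proof -
  have "elem_sym r {i + 1..j - 1} (\<lambda>l. - shift a \<alpha> l) = elem_sym r {i + a + 1..j + a - 1} (\<lambda>l. - \<alpha> l)" for r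
    using elem_sym_shift[of r "i + 1" "j - 1" "\<lambda>l. - \<alpha> l" a] by (simp add: shift_def algebra_simps)
  moreover have "comp_sym s {i..j} (shift a \<beta>) = comp_sym s {i + a..j + a} \<beta>" for s
    using comp_sym_shift[of s i j \<beta> a] by (simp add: shift_def[abs_def])
  moreover have "shift a \<alpha> j = \<alpha> (j + a)" "shift a \<beta> j = \<beta> (j + a)" "shift a \<beta> i = \<beta> (i + a)"
    by (simp_all add: shift_def)
  ultimately have "current_coeff (shift a \<alpha>) (shift a \<beta>) k i j = current_coeff \<alpha> \<beta> k (i + a) (j + a)" for k
    by (simp only: current_coeff_def add_less_cancel_right add_right_cancel add_diff_cancel_right)
  then show ?thesis
    by (simp add: current_matrix_def)
qed

section \<open>Partitions as sets of particles\<close>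

definition position :: "nat list \<Rightarrow> nat \<Rightarrow> int" where
  "position la i = int (part la i) - int i + 1"

lemma part_antimono:
  assumes "sorted_wrt (\<ge>) la" "1 \<le> i" "i \<le> j"
  shows "part la j \<le> part la i"
proof (cases "i = j \<or> length la < j")
  case False
  then have "la ! (i - 1) \<ge> la ! (j - 1)"
    using assms by (intro sorted_wrt_nth_less[OF assms(1)]) auto
  then show ?thesis
    using assms by (simp add: part_def)
qed (auto simp: part_def)

lemma position_strict_antimono:
  "sorted_wrt (\<ge>) la \<Longrightarrow> 1 \<le> i \<Longrightarrow> i < j \<Longrightarrow> position la j < position la i"
  using part_antimono[of la i j] by (simp add: position_def)

lemma part_set_eq:
  assumes "length la \<le> n"
  shows "part_set la = (\<lambda>p. position la (p + 1)) ` {..<n} \<union> {..- int n}"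
proof (intro equalityI subsetI)
  fix s assume "s \<in> part_set la"
  then obtain i where i: "1 \<le> i" "s = position la i"
    by (auto simp: part_set_def position_def)
  show "s \<in> (\<lambda>p. position la (p + 1)) ` {..<n} \<union> {..- int n}"
  proof (cases "i \<le> n")
    case True
    then show ?thesis
      using i by (intro UnI1 image_eqI[of _ _ "i - 1"]) auto
  next
    case False
    then show ?thesis
      using i assms by (auto simp: position_def part_def)
  qed
next
  fix s assume "s \<in> (\<lambda>p. position la (p + 1)) ` {..<n} \<union> {..- int n}"
  then show "s \<in> part_set la"
  proof
    assume "s \<in> {..- int n}"
    then have "s = int (part la (nat (1 - s))) - int (nat (1 - s)) + 1" "1 \<le> nat (1 - s)"
      using assms by (auto simp: part_def)
    then show ?thesis unfolding part_set_def by blast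
  qed (auto simp: part_set_def position_def intro: exI[of _ "Suc _"])
qed

lemma box_supported_part_set:
  assumes "sorted_wrt (\<ge>) la" "length la \<le> N" "part la 1 \<le> N"
  shows "box_supported N (basis_vec (part_set la))"
proof -
  have "position la (p + 1) \<le> int N" for p
    using part_antimono[OF assms(1), of 1 "p + 1"] assms(3) by (simp add: position_def)
  then show ?thesis
    using assms(2) unfolding part_set_eq[OF assms(2)] by (auto simp: box_supported_def basis_vec_def split: if_splits)
qed

lemma maya_part_set: "maya (part_set la)"
proof -
  have eq: "part_set la = (\<lambda>p. position la (p + 1)) ` {..<length la} \<union> {..- int (length la)}"
    by (rule part_set_eq) simp
  have "part_set la \<inter> {0<..} \<subseteq> (\<lambda>p. position la (p + 1)) ` {..<length la}"
    unfolding eq by auto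
  then have "finite (part_set la \<inter> {0<..})"
    by (rule finite_subset) simp
  moreover have "finite ({..0} - part_set la)"
    unfolding eq by (rule finite_subset[of _ "{- int (length la)..0}"]) auto
  ultimately show ?thesis by (simp add: maya_def)
qed

text \<open>
  The rows with at least \<open>j\<close> cells form an initial segment, whose length is the part number \<open>j\<close> of the
  conjugate: both sides say that the cell \<open>(i, j)\<close> lies in the Young diagram.
\<close>

lemma conj_threshold:
  assumes "sorted_wrt (\<ge>) la" "1 \<le> i" "1 \<le> j"
  shows "j \<le> part la i \<longleftrightarrow> i \<le> part (conj_partition la) j"
proof -
  define C where "C = {i. 1 \<le> i \<and> j \<le> part la i}"
  have sub: "C \<subseteq> {1..length la}"
    using assms(3) by (auto simp: C_def part_def split: if_splits)
  then have fin: "finite C" by (rule finite_subset) simp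
  have down: "i' \<in> C" if "i \<in> C" "1 \<le> i'" "i' \<le> i" for i i'
    using part_antimono[OF assms(1) that(2,3)] that by (auto simp: C_def)
  have C: "C = {1..card C}"
  proof (cases "C = {}")
    case False
    have "C = {1..Max C}"
    proof (intro equalityI subsetI)
      show "x \<in> {1..Max C}" if "x \<in> C" for x
        using that sub Max_ge[OF fin that] by auto
      show "x \<in> C" if "x \<in> {1..Max C}" for x
        using down[OF Max_in[OF fin False]] that by simp
    qed
    then show ?thesis by (metis card_atLeastAtMost diff_Suc_1)
  qed simp
  have "part (conj_partition la) j = card C"
  proof (cases "j \<le> part la 1")
    case True
    moreover have "[1..<part la 1 + 1] ! (j - 1) = j"
      using True assms(3) by (simp del: upt_Suc)
    ultimately show ?thesis
      using assms(3) unfolding part_def[of "conj_partition la" j]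
      by (simp add: conj_partition_def C_def del: upt_Suc)
  next
    case False
    then have "C = {}"
      using down[of _ 1] by (auto simp: C_def)
    then show ?thesis
      using False unfolding part_def[of "conj_partition la" j]
      by (simp add: conj_partition_def del: upt_Suc)
  qed
  moreover have "j \<le> part la i \<longleftrightarrow> i \<in> C"
    using assms(2) by (simp add: C_def)
  moreover have "i \<in> C \<longleftrightarrow> i \<le> card C"
    using assms(2) C by (metis atLeastAtMost_iff)
  ultimately show ?thesis by simp
qed

lemma length_conj_partition [simp]: "length (conj_partition la) = part la 1"
  by (simp add: conj_partition_def)

lemma sorted_conj_partition:
  assumes "sorted_wrt (\<ge>) la"
  shows "sorted_wrt (\<ge>) (conj_partition la)"
  unfolding sorted_wrt_iff_nth_less
proof (intro allI impI)
  fix a b assume ab: "a < b" "b < length (conj_partition la)"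
  let ?p = "part (conj_partition la)"
  have "?p (b + 1) \<le> ?p (a + 1)"
  proof (cases "?p (b + 1) = 0")
    case False
    then have "b + 1 \<le> part la (?p (b + 1))"
      using conj_threshold[OF assms, of "?p (b + 1)" "b + 1"] by simp
    then show ?thesis
      using ab False conj_threshold[OF assms, of "?p (b + 1)" "a + 1"] by simp
  qed simp
  then show "conj_partition la ! a \<ge> conj_partition la ! b"
    using ab by (simp add: part_def)
qed

text \<open>
  Walking along the boundary of the Young diagram, vertical steps are particles and horizontal ones
  are holes.  Thus the particles of \<open>la\<close> and the reflected particles of its conjugate never meet, by
  \<open>conj_threshold\<close>, and together they fill all positions.
\<close>

lemma part_set_conj_partition:
  assumes "sorted_wrt (\<ge>) la"
  shows "part_set (conj_partition la) = holes (part_set la)"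
proof (intro equalityI subsetI)
  let ?p = "part (conj_partition la)"
  fix s assume "s \<in> part_set (conj_partition la)"
  then obtain j where j: "1 \<le> j" "s = int (?p j) - int j + 1"
    by (auto simp: part_set_def)
  have "1 - s \<noteq> int (part la i) - int i + 1" if "1 \<le> i" for i
    using conj_threshold[OF assms that j(1)] j(2) by (cases "j \<le> part la i") auto
  then show "s \<in> holes (part_set la)"
    by (auto simp: mem_holes part_set_def)
next
  let ?p = "part (conj_partition la)"
  fix s assume "s \<in> holes (part_set la)"
  then have s: "1 - s \<noteq> int (part la i) - int i + 1" if "1 \<le> i" for i
    using that by (auto simp: mem_holes part_set_def)
  \<comment> \<open>The position \<open>1 - s\<close> lies above the particle \<open>i\<close> and, if \<open>i > 1\<close>, below the particle \<open>i - 1\<close>, so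
    the boundary step there ends column \<open>j = i - s\<close> at height \<open>i - 1\<close>.\<close>
  define i where "i = (LEAST i. 1 \<le> i \<and> int (part la i) - int i + 1 \<le> 1 - s)"
  have "1 \<le> i \<and> int (part la i) - int i + 1 \<le> 1 - s"
    unfolding i_def
    by (rule LeastI[of _ "part la 1 + nat s + 1"])
      (use part_antimono[OF assms, of 1 "part la 1 + nat s + 1"] in auto)
  then have i: "1 \<le> i" "int (part la i) - int i + 1 < 1 - s"
    using s[of i] by auto
  define j where "j = nat (int i - s)"
  have j: "int j = int i - s" "part la i < j"
    using i(2) by (auto simp: j_def)
  have "?p j < i"
    using conj_threshold[OF assms i(1), of j] j(2) by linarith
  moreover have "i - 1 \<le> ?p j"
  proof (cases "i = 1")
    case False
    then have "\<not> (1 \<le> i - 1 \<and> int (part la (i - 1)) - int (i - 1) + 1 \<le> 1 - s)"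
      using i(1) unfolding i_def by (intro not_less_Least) simp
    then have "j \<le> part la (i - 1)"
      using False i(1) j(1) by auto
    then show ?thesis
      using conj_threshold[OF assms, of "i - 1" j] False i(1) j(2) by simp
  qed simp
  ultimately have "s = int (?p j) - int j + 1" "1 \<le> j"
    using i(1) j by auto
  then show "s \<in> part_set (conj_partition la)"
    unfolding part_set_def by blast
qed

section \<open>Determinantal formulas for skew functions\<close>

lemma evolve_part_set:
  assumes A: "upper_linear A" and la: "sorted_wrt (\<ge>) la" and mu: "sorted_wrt (\<ge>) mu"
    and n: "length la \<le> n" "length mu \<le> n" and N: "n \<le> N" "part la 1 \<le> N" "part mu 1 \<le> N"
  shows "evolve A N (part_set la) (part_set mu) =
    mfps_exp (- (\<Sum>i\<in>{- int n<..0}. A i i)) * det1 n (\<lambda>i j. tri_exp A (position mu j) (position la i))"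
proof -
  have in_box: "position l (p + 1) \<in> box N \<inter> {- int n<..}"
    if "p < n" "sorted_wrt (\<ge>) l" "part l 1 \<le> N" for p l
    using part_antimono[OF that(2), of 1 "p + 1"] that N(1) by (auto simp: position_def box_def)
  show ?thesis
    unfolding part_set_eq[OF n(1)] part_set_eq[OF n(2)] det1_def
    by (subst evolve_eq_det[OF A N(1)])
      (use in_box la mu N position_strict_antimono in auto)
qed

lemma skew_schur_eq_evolve:
  assumes "sorted_wrt (\<ge>) la" "length la \<le> N" "part la 1 \<le> N"
  shows "skew_schur la mu \<alpha> \<beta> = evolve (current_matrix \<alpha> \<beta>) N (part_set la) (part_set mu)"
  unfolding skew_schur_def
  using exp_H_plus_eq_evolve[OF box_supported_part_set[OF assms], of \<alpha> \<beta>]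
  by (simp add: ket_def[abs_def] basis_vec_def[abs_def])

lemma current_matrix_diag_sum:
  "(\<Sum>i\<in>I. current_matrix \<alpha> \<beta> i i) = power_sum_form (\<lambda>k. \<Sum>i\<in>I. \<beta> i ^ k)"
  unfolding power_sum_form_sum by (simp add: current_matrix_def current_coeff_def)

lemma Lam_eq_power_sum_form:
  "Lam m \<beta> = power_sum_form (\<lambda>k. (\<Sum>j\<in>{0<..m}. \<beta> j ^ k) - (\<Sum>j\<in>{m<..0}. \<beta> j ^ k))"
  by (simp only: Lam_def power_sum_form_def)

lemma Lam_nonpos: "Lam (- int n) \<beta> = - (\<Sum>i\<in>{- int n<..0}. current_matrix \<alpha> \<beta> i i)"
  unfolding Lam_eq_power_sum_form current_matrix_diag_sum power_sum_form_uminus[symmetric] by simp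

lemma Lam_nonneg: "Lam (int n) \<beta> = (\<Sum>i\<in>{0<..int n}. current_matrix \<alpha> \<beta> i i)"
  unfolding Lam_eq_power_sum_form current_matrix_diag_sum by simp

lemma skew_schur_particles:
  assumes la: "sorted_wrt (\<ge>) la" and mu: "sorted_wrt (\<ge>) mu" and n: "length la \<le> n" "length mu \<le> n"
  shows "skew_schur la mu \<alpha> \<beta> = mfps_exp (Lam (- int n) \<beta>) *
    det1 n (\<lambda>i j. tri_exp (current_matrix \<alpha> \<beta>) (position mu j) (position la i))"
proof -
  define N where "N = n + part la 1 + part mu 1"
  have "skew_schur la mu \<alpha> \<beta> = evolve (current_matrix \<alpha> \<beta>) N (part_set la) (part_set mu)"
    by (rule skew_schur_eq_evolve[OF la]) (use n in \<open>auto simp: N_def\<close>)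
  then show ?thesis
    unfolding Lam_nonpos[of _ _ \<alpha>]
    by (simp add: evolve_part_set[OF upper_linear_current_matrix la mu n] N_def)
qed

text \<open>
  The determinantal formula \<open>evolve_part_set\<close> for the dual matrix and the conjugate partitions: by
  \<open>evolve_holes\<close> the same matrix coefficient can be computed by following the holes.
\<close>

lemma skew_schur_holes:
  assumes la: "sorted_wrt (\<ge>) la" and mu: "sorted_wrt (\<ge>) mu"
    and n: "length (conj_partition la) \<le> n" "length (conj_partition mu) \<le> n"
  shows "skew_schur la mu \<alpha> \<beta> = mfps_exp (Lam (int n) \<beta>) *
    det1 n (\<lambda>i j. tri_exp (hole_dual (current_matrix \<alpha> \<beta>))
      (position (conj_partition mu) j) (position (conj_partition la) i))"
proof -
  let ?A = "current_matrix \<alpha> \<beta>" and ?la = "conj_partition la" and ?mu = "conj_partition mu"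
  define N where "N = n + length la + part la 1 + part ?la 1 + part ?mu 1"
  have "(\<Sum>i\<in>{- int n<..0}. hole_dual ?A i i) = (\<Sum>i\<in>{0<..int n}. - ?A i i)"
    by (rule sum.reindex_bij_witness[where i = "\<lambda>i. 1 - i" and j = "\<lambda>i. 1 - i"]) (auto simp: hole_dual_def)
  then have Lam: "Lam (int n) \<beta> = - (\<Sum>i\<in>{- int n<..0}. hole_dual ?A i i)"
    by (simp add: Lam_nonneg[of n \<beta> \<alpha>] sum_negf)
  have "skew_schur la mu \<alpha> \<beta> = evolve ?A N (part_set la) (part_set mu)"
    by (rule skew_schur_eq_evolve[OF la]) (auto simp: N_def)
  also have "\<dots> = evolve (hole_dual ?A) N (part_set ?la) (part_set ?mu)"
    using evolve_holes[OF upper_linear_current_matrix maya_part_set]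
    by (simp add: part_set_conj_partition la mu)
  also have "\<dots> = mfps_exp (Lam (int n) \<beta>) *
      det1 n (\<lambda>i j. tri_exp (hole_dual ?A) (position ?mu j) (position ?la i))"
    unfolding Lam
    by (rule evolve_part_set[OF upper_linear_hole_dual[OF upper_linear_current_matrix]
          sorted_conj_partition[OF la] sorted_conj_partition[OF mu] n]) (auto simp: N_def)
  finally show ?thesis .
qed

lemma det1_1: "det1 1 M = M 1 1"
  by (simp add: det1_def det_single)

lemma homogeneous_xi: "homogeneous 1 (xi z)"
  using homogeneous_power_sum_form[of "\<lambda>k. z ^ k"] by (simp add: xi_def power_sum_form_def)

text \<open>
  The case of one row and one particle identifies the entries of \<open>e\<^sup>A\<close>; translating the parameters
  by \<open>a\<close> moves the target of the particle from \<open>0\<close> to \<open>a\<close>.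
\<close>

lemma exp_xi_h_fun:
  "mfps_exp (xi (\<beta> a)) * h_fun k (shift a \<alpha>) (shift a \<beta>) = tri_exp (current_matrix \<alpha> \<beta>) a (a + k)"
proof (cases "k < 0")
  case True
  then show ?thesis by (simp add: h_fun_def tri_exp_lower)
next
  case False
  define la where "la = (if k = 0 then [] else [nat k])"
  have "{- 1<..0} = {0 :: int}" by auto
  then have "Lam (- int 1) (shift a \<beta>) = - xi (\<beta> a)"
    using Lam_nonpos[of 1 "shift a \<beta>" \<alpha>] by (simp add: current_matrix_diag shift_def)
  moreover have "position la 1 = k" "position [] 1 = 0"
    using False by (auto simp: position_def la_def part_def)
  moreover have "h_fun k (shift a \<alpha>) (shift a \<beta>) = skew_schur la [] (shift a \<alpha>) (shift a \<beta>)"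
    using False by (simp add: h_fun_def schur_def la_def)
  moreover have "skew_schur la [] (shift a \<alpha>) (shift a \<beta>) = mfps_exp (Lam (- int 1) (shift a \<beta>)) *
      det1 1 (\<lambda>i j. tri_exp (current_matrix (shift a \<alpha>) (shift a \<beta>)) (position [] j) (position la i))"
    by (rule skew_schur_particles) (auto simp: la_def)
  moreover have "tri_exp (current_matrix (shift a \<alpha>) (shift a \<beta>)) 0 k = tri_exp (current_matrix \<alpha> \<beta>) a (a + k)"
    unfolding current_matrix_shift[abs_def] tri_exp_shift by (simp add: add.commute)
  ultimately show ?thesis
    using mfps_exp_inverse[OF homogeneous_xi, of "\<beta> a"]
    by (simp add: det1_1 mult.assoc[symmetric] del: One_nat_def)
qed

text \<open>
  Likewise for one column and one hole.  Reflection reverses the direction of translations, hence the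
  shift by \<open>-c\<close>.
\<close>

lemma exp_xi_e_fun:
  "mfps_exp (- xi (\<beta> (1 - c))) * e_fun k (shift (- c) \<alpha>) (shift (- c) \<beta>) =
    tri_exp (hole_dual (current_matrix \<alpha> \<beta>)) c (c + k)"
proof (cases "k < 0")
  case True
  then show ?thesis by (simp add: e_fun_def tri_exp_lower)
next
  case False
  let ?A = "current_matrix (shift (- c) \<alpha>) (shift (- c) \<beta>)"
  define la :: "nat list" where "la = replicate (nat k) 1"
  have sorted: "sorted_wrt (\<ge>) la"
    by (auto simp: la_def sorted_wrt_iff_nth_less)
  have part: "part la i = (if 1 \<le> i \<and> i \<le> nat k then 1 else 0)" for i
    by (auto simp: la_def part_def)
  have "{0<..1} = {1 :: int}" by auto
  then have "Lam (int 1) (shift (- c) \<beta>) = xi (\<beta> (1 - c))"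
    using Lam_nonneg[of 1 "shift (- c) \<beta>" \<alpha>] by (simp add: current_matrix_diag shift_def)
  moreover have "position (conj_partition la) 1 = k"
  proof -
    have "i \<le> part (conj_partition la) 1 \<longleftrightarrow> i \<le> nat k" if "1 \<le> i" for i
      using conj_threshold[OF sorted that, of 1] that by (auto simp: part split: if_splits)
    then have "part (conj_partition la) 1 = nat k"
      by (metis le_antisym linorder_not_less less_one nat_le_linear le0)
    then show ?thesis using False by (simp add: position_def)
  qed
  moreover have "position (conj_partition []) 1 = 0"
    by (simp add: position_def part_def conj_partition_def)
  moreover have "e_fun k (shift (- c) \<alpha>) (shift (- c) \<beta>) = skew_schur la [] (shift (- c) \<alpha>) (shift (- c) \<beta>)"
    using False by (simp add: e_fun_def schur_def la_def)
  moreover have "skew_schur la [] (shift (- c) \<alpha>) (shift (- c) \<beta>) = mfps_exp (Lam (int 1) (shift (- c) \<beta>)) *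
      det1 1 (\<lambda>i j. tri_exp (hole_dual ?A) (position (conj_partition []) j) (position (conj_partition la) i))"
    by (rule skew_schur_holes) (auto simp: sorted part, simp add: part_def)
  moreover have "tri_exp (hole_dual ?A) 0 k = tri_exp (hole_dual (current_matrix \<alpha> \<beta>)) c (c + k)"
  proof -
    have "hole_dual ?A = (\<lambda>i j. hole_dual (current_matrix \<alpha> \<beta>) (i + c) (j + c))"
      by (intro ext) (simp add: hole_dual_def current_matrix_shift algebra_simps)
    then show ?thesis
      by (simp add: tri_exp_shift add.commute)
  qed
  ultimately show ?thesis
    using mfps_exp_inverse[OF homogeneous_xi, of "\<beta> (1 - c)"]
    by (simp add: det1_1 mult.assoc[symmetric] mult.commute[of "mfps_exp (- _)"] del: One_nat_def)
qed

theorem theorem5p13: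
  fixes la mu :: "nat list" and \<alpha> \<beta> :: "int \<Rightarrow> complex"
  assumes "is_partition la" and "is_partition mu"
  shows
    "(\<forall>n \<ge> max (length la) (length mu).
        skew_schur la mu \<alpha> \<beta> =
          mfps_exp (Lam (- int n) \<beta>) *
          det1 n (\<lambda>i j.
            mfps_exp (xi (\<beta> (int (part mu j) - int j + 1))) *
            h_fun (int (part la i) - int (part mu j) - int i + int j)
              (shift (int (part mu j) - int j + 1) \<alpha>)
              (shift (int (part mu j) - int j + 1) \<beta>))) \<and>
     (\<forall>n \<ge> max (length (conj_partition la)) (length (conj_partition mu)).
        skew_schur la mu \<alpha> \<beta> =
          mfps_exp (Lam (int n) \<beta>) *
          det1 n (\<lambda>i j.
            mfps_exp (- xi (\<beta> (int j - int (part (conj_partition mu) j)))) *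
            e_fun (int (part (conj_partition la) i) - int (part (conj_partition mu) j) - int i + int j)
              (shift (int j - int (part (conj_partition mu) j) - 1) \<alpha>)
              (shift (int j - int (part (conj_partition mu) j) - 1) \<beta>)))"
proof (intro conjI allI impI)
  have sorted: "sorted_wrt (\<ge>) la" "sorted_wrt (\<ge>) mu"
    using assms by (simp_all add: is_partition_def)
  {
    fix n assume n: "max (length la) (length mu) \<le> n"
    have entry: "mfps_exp (xi (\<beta> (int (part mu j) - int j + 1))) *
            h_fun (int (part la i) - int (part mu j) - int i + int j)
              (shift (int (part mu j) - int j + 1) \<alpha>) (shift (int (part mu j) - int j + 1) \<beta>)
        = tri_exp (current_matrix \<alpha> \<beta>) (position mu j) (position la i)" for i j
      unfolding exp_xi_h_fun by (simp add: position_def algebra_simps)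
    show "skew_schur la mu \<alpha> \<beta> =
          mfps_exp (Lam (- int n) \<beta>) *
          det1 n (\<lambda>i j.
            mfps_exp (xi (\<beta> (int (part mu j) - int j + 1))) *
            h_fun (int (part la i) - int (part mu j) - int i + int j)
              (shift (int (part mu j) - int j + 1) \<alpha>)
              (shift (int (part mu j) - int j + 1) \<beta>))"
      unfolding entry using n by (intro skew_schur_particles sorted) auto
  next
    fix n assume n: "max (length (conj_partition la)) (length (conj_partition mu)) \<le> n"
    let ?la = "conj_partition la" and ?mu = "conj_partition mu"
    have entry: "mfps_exp (- xi (\<beta> (int j - int (part ?mu j)))) *
            e_fun (int (part ?la i) - int (part ?mu j) - int i + int j)
              (shift (int j - int (part ?mu j) - 1) \<alpha>) (shift (int j - int (part ?mu j) - 1) \<beta>)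
        = tri_exp (hole_dual (current_matrix \<alpha> \<beta>)) (position ?mu j) (position ?la i)" for i j
      using exp_xi_e_fun[of \<beta> "position ?mu j" "int (part ?la i) - int (part ?mu j) - int i + int j" \<alpha>]
      by (simp add: position_def algebra_simps)
    show "skew_schur la mu \<alpha> \<beta> =
          mfps_exp (Lam (int n) \<beta>) *
          det1 n (\<lambda>i j.
            mfps_exp (- xi (\<beta> (int j - int (part ?mu j)))) *
            e_fun (int (part ?la i) - int (part ?mu j) - int i + int j)
              (shift (int j - int (part ?mu j) - 1) \<alpha>)
              (shift (int j - int (part ?mu j) - 1) \<beta>))"
      unfolding entry using n by (intro skew_schur_holes sorted) auto
  }
qed

end
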